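(* Let $G$ be a finitely generated group, $H\le G$ a finite-index subgroup, and $\mu$ an adapted and smooth probability measure on $G$. Let $\mu_H$ be the hitting law of the $\mu$-random walk on $H$. Then restriction $f\mapsto f|_H$ defines a linear isomorphism $$\mathrm{Res}_H^G:\mathrm{LHF}(G,\mu)\to\mathrm{LHF}(H,\mu_H),$$ whose inverse is harmonic induction $$\mathrm{Ind}_H^G(\tilde f)(x):=\mathbb E_x\big[\tilde f(X_\tau)\big],\qquad \tau:=\inf\{t\ge0: X_t\in H\}.$$ Moreover, for any finite symmetric generating sets $S_G$ of $G$ and $S_H$ of $H$ there exist constants $C_\ast$, $C_{H,G}$ (depending only on $G$, $H$, the generating sets and the measure) such that for all $\tilde f\in\mathrm{LHF}(H,\mu_H)$ and all $f\in\mathrm{LHF}(G,\mu)$, $$\|\nabla_{S_G}(\mathrm{Ind}_H^G\tilde f)\|_\infty\le C_\ast\|\nabla_{S_H}\tilde f\|_\infty,\qquad \|\nabla_{S_H}(\mathrm{Res}_H^G f)\|_\infty\le C_{H,G}\|\nabla_{S_G}f\|_\infty.$$ In particular, $\mathrm{LHF}$ is stable, as a seminormed affine space, under passage to finite-index subgroups and supergroups.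
   Context: For a finitely generated group $G$ with finite symmetric generating set $S$, $|x|$ is the word length. A probability measure $\mu$ is adapted if the semigroup generated by its support is $G$, and smooth if $\sum_x\mu(x)e^{\zeta|x|}<\infty$ for some $\zeta>0$. $f:G\to\mathbb C$ is $\mu$-harmonic if $f(k)=\sum_g\mu(g)f(kg)$ (absolutely convergent) for all $k$. $\|\nabla_S f\|_\infty=\sup_{s\in S,x\in G}|f(xs)-f(x)|$; $f$ is Lipschitz if this is finite. $\mathrm{LHF}(G,\mu)$ is the space of Lipschitz $\mu$-harmonic functions. The (right) random walk is $X_{t+1}=X_t\xi_{t+1}$ with $(\xi_t)_{t\ge1}$ i.i.d. of law $\mu$; $\mathbb P_x,\mathbb E_x$ refer to the walk with $X_0=x$. The hitting law on $H$ is $\mu_H(y)=\mathbb P_e(X_{\tau^+}=y)$, $y\in H$, where $\tau^+=\inf\{t\ge1:X_t\in H\}$. *)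

theory Defs
  imports "HOL-Probability.Probability" "HOL-Algebra.Generated_Groups"
begin

section \<open>Finitely generated groups, word length, measures on groups\<close>

definition fin_sym_gen :: "('a, 'b) monoid_scheme \<Rightarrow> 'a set \<Rightarrow> bool" where
  "fin_sym_gen G S \<longleftrightarrow> finite S \<and> S \<subseteq> carrier G \<and> (\<forall>s\<in>S. inv\<^bsub>G\<^esub> s \<in> S) \<and> generate G S = carrier G"

definition word_length :: "('a, 'b) monoid_scheme \<Rightarrow> 'a set \<Rightarrow> 'a \<Rightarrow> nat" where
  "word_length G S x =
     (LEAST n. \<exists>w. length w = n \<and> set w \<subseteq> S \<and> foldr (\<lambda>s y. s \<otimes>\<^bsub>G\<^esub> y) w \<one>\<^bsub>G\<^esub> = x)"

inductive_set semigroup_generate :: "('a, 'b) monoid_scheme \<Rightarrow> 'a set \<Rightarrow> 'a set"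
  for G and A where
    incl: "a \<in> A \<Longrightarrow> a \<in> semigroup_generate G A"
  | mult: "a \<in> semigroup_generate G A \<Longrightarrow> b \<in> semigroup_generate G A
           \<Longrightarrow> a \<otimes>\<^bsub>G\<^esub> b \<in> semigroup_generate G A"

definition adapted :: "('a, 'b) monoid_scheme \<Rightarrow> 'a pmf \<Rightarrow> bool" where
  "adapted G \<mu> \<longleftrightarrow> semigroup_generate G (set_pmf \<mu>) = carrier G"

definition smooth :: "('a, 'b) monoid_scheme \<Rightarrow> 'a set \<Rightarrow> 'a pmf \<Rightarrow> bool" where
  "smooth G S \<mu> \<longleftrightarrow>
     (\<exists>\<zeta>>0. (\<lambda>x. pmf \<mu> x * exp (\<zeta> * real (word_length G S x))) summable_on carrier G)"

section \<open>Lipschitz harmonic functions\<close>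

text \<open>
  Functions on a group are the elements of \<^term>\<open>extensional (carrier G)\<close>, so that two of them
  are equal as soon as they agree on the carrier. In \<open>harmonic\<close> and \<open>LHF\<close> a measure on the group
  is given by its mass function, so that the definitions apply both to \<^term>\<open>pmf \<mu>\<close> and to the
  hitting law below.
\<close>

definition harmonic :: "('a, 'b) monoid_scheme \<Rightarrow> ('a \<Rightarrow> real) \<Rightarrow> ('a \<Rightarrow> complex) \<Rightarrow> bool" where
  "harmonic G m f \<longleftrightarrow>
     (\<forall>k\<in>carrier G.
        (\<lambda>g. norm (of_real (m g) * f (k \<otimes>\<^bsub>G\<^esub> g))) summable_on carrier G \<and>
        f k = infsum (\<lambda>g. of_real (m g) * f (k \<otimes>\<^bsub>G\<^esub> g)) (carrier G))"

text \<open>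
  The supremum is taken in \<^typ>\<open>ennreal\<close>: it is \<^term>\<open>\<infinity> :: ennreal\<close> for a function that is not
  Lipschitz, and \<open>0\<close> for the empty generating set of the trivial group.
\<close>

definition grad_norm :: "('a, 'b) monoid_scheme \<Rightarrow> 'a set \<Rightarrow> ('a \<Rightarrow> complex) \<Rightarrow> ennreal" where
  "grad_norm G S f = (SUP (s, x) \<in> S \<times> carrier G. ennreal (cmod (f (x \<otimes>\<^bsub>G\<^esub> s) - f x)))"

definition LHF :: "('a, 'b) monoid_scheme \<Rightarrow> 'a set \<Rightarrow> ('a \<Rightarrow> real) \<Rightarrow> ('a \<Rightarrow> complex) set" where
  "LHF G S m = {f \<in> extensional (carrier G). grad_norm G S f < \<infinity> \<and> harmonic G m f}"

section \<open>Random walk, hitting times, hitting law\<close>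

text \<open>
  A path records the increments: \<open>\<omega> !! t\<close> is \<open>\<xi>\<^sub>t\<^sub>+\<^sub>1\<close>. The step law is restricted to the
  (countable) carrier so that the group operation is measurable whatever the size of the type
  \<^typ>\<open>'a\<close>.
\<close>

definition walk_space :: "('a, 'b) monoid_scheme \<Rightarrow> 'a pmf \<Rightarrow> 'a stream measure" where
  "walk_space G \<mu> = stream_space (restrict_space (measure_pmf \<mu>) (carrier G))"

primrec walk :: "('a, 'b) monoid_scheme \<Rightarrow> 'a \<Rightarrow> 'a stream \<Rightarrow> nat \<Rightarrow> 'a" where
  "walk G x \<omega> 0 = x"
| "walk G x \<omega> (Suc t) = walk G x \<omega> t \<otimes>\<^bsub>G\<^esub> (\<omega> !! t)"

text \<open>\<open>hitting_time 0\<close> is \<open>\<tau>\<close> and \<open>hitting_time 1\<close> is \<open>\<tau>\<^sup>+\<close>; the infimum of the empty set is \<open>\<infinity>\<close>.\<close>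

definition hitting_time :: "nat \<Rightarrow> 'a set \<Rightarrow> (nat \<Rightarrow> 'a) \<Rightarrow> enat" where
  "hitting_time t0 H X = Inf (enat ` {t. t0 \<le> t \<and> X t \<in> H})"

definition hitting_law :: "('a, 'b) monoid_scheme \<Rightarrow> 'a set \<Rightarrow> 'a pmf \<Rightarrow> 'a \<Rightarrow> real" where
  "hitting_law G H \<mu> y =
     measure (walk_space G \<mu>)
       {\<omega> \<in> space (walk_space G \<mu>).
          hitting_time 1 H (walk G \<one>\<^bsub>G\<^esub> \<omega>) < \<infinity> \<and>
          walk G \<one>\<^bsub>G\<^esub> \<omega> (the_enat (hitting_time 1 H (walk G \<one>\<^bsub>G\<^esub> \<omega>))) = y}"

text \<open>
  \<open>stopped_value\<close> is \<open>f (X\<^sub>\<tau>)\<close>, with value \<open>0\<close> on the event \<open>\<tau> = \<infinity>\<close>.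
\<close>

definition stopped_value ::
    "('a, 'b) monoid_scheme \<Rightarrow> 'a set \<Rightarrow> ('a \<Rightarrow> complex) \<Rightarrow> 'a \<Rightarrow> 'a stream \<Rightarrow> complex" where
  "stopped_value G H f x \<omega> =
     (let X = walk G x \<omega>; \<tau> = hitting_time 0 H X in if \<tau> < \<infinity> then f (X (the_enat \<tau>)) else 0)"

section \<open>Restriction and harmonic induction\<close>

definition Res :: "'a set \<Rightarrow> ('a \<Rightarrow> complex) \<Rightarrow> ('a \<Rightarrow> complex)" where
  "Res H f = restrict f H"

definition Ind ::
    "('a, 'b) monoid_scheme \<Rightarrow> 'a set \<Rightarrow> 'a pmf \<Rightarrow> ('a \<Rightarrow> complex) \<Rightarrow> ('a \<Rightarrow> complex)" where
  "Ind G H \<mu> f = (\<lambda>x\<in>carrier G. LINT \<omega>|walk_space G \<mu>. stopped_value G H f x \<omega>)"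

section \<open>Linear isomorphisms between spaces of functions\<close>

definition function_subspace :: "'a set \<Rightarrow> ('a \<Rightarrow> complex) set \<Rightarrow> bool" where
  "function_subspace A V \<longleftrightarrow>
     V \<subseteq> extensional A \<and> (\<lambda>x\<in>A. 0) \<in> V \<and>
     (\<forall>f\<in>V. \<forall>g\<in>V. (\<lambda>x\<in>A. f x + g x) \<in> V) \<and>
     (\<forall>c. \<forall>f\<in>V. (\<lambda>x\<in>A. c * f x) \<in> V)"

definition linear_iso ::
    "'a set \<Rightarrow> ('a \<Rightarrow> complex) set \<Rightarrow> 'b set \<Rightarrow> ('b \<Rightarrow> complex) set
     \<Rightarrow> (('a \<Rightarrow> complex) \<Rightarrow> ('b \<Rightarrow> complex)) \<Rightarrow> bool" where
  "linear_iso A V B W T \<longleftrightarrow>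
     function_subspace A V \<and> function_subspace B W \<and> bij_betw T V W \<and>
     (\<forall>f\<in>V. \<forall>g\<in>V. T (\<lambda>x\<in>A. f x + g x) = (\<lambda>x\<in>B. T f x + T g x)) \<and>
     (\<forall>c. \<forall>f\<in>V. T (\<lambda>x\<in>A. c * f x) = (\<lambda>x\<in>B. c * T f x))"

end

theory Submission
  imports Defs
begin

text \<open>
  Write \<open>\<tau>\<close> for the hitting time of \<open>H\<close>. The coset \<open>H X\<^sub>t\<close> is a finite irreducible Markov chain, so the
  expectation of \<open>\<tau>\<close> is bounded uniformly in the starting point; since the steps have a first moment,
  Wald's estimate bounds the expected displacement up to \<open>\<tau>\<close>, again uniformly. A Lipschitz function
  on \<open>H\<close> extends, constantly along a transversal, to a Lipschitz function \<open>F\<close> on \<open>G\<close>; hence its harmonic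
  induction exists, stays at bounded distance from \<open>F\<close>, and is Lipschitz. It is harmonic off \<open>H\<close> by the
  first-step decomposition, and on \<open>H\<close> precisely because the function is harmonic for the hitting law.
  Conversely, for \<open>f\<close> Lipschitz harmonic on \<open>G\<close>, the difference between \<open>f\<close> and the induction of its
  restriction is bounded, vanishes on \<open>H\<close> and is harmonic off \<open>H\<close>, so it is dominated by the tail of
  \<open>\<tau>\<close> and vanishes.
\<close>

section \<open>Sums, integrals and streams\<close>

text \<open>The argument never conditions on \<tau>: every quantity is controlled by splitting off
  the first increment of the path. This is why the tail of \<tau> enters as the recursively defined
  \<open>avoid_prob\<close> and is only afterwards compared with the path measure. The walk
  multiplies on the right, so left multiplication by \<open>H\<close> commutes with it and preserves
  the set \<open>H\<close>. Hence avoidance probabilities take finitely many values, and the hitting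
  law at the identity also describes the return from every other point of \<open>H\<close>. The
  obstacle is that Lipschitz functions are unbounded, and that a function on \<open>H\<close> has no
  values at the intermediate positions of the walk. Both are met by comparing the stopped value with
  the extension at the starting point: the stopped value sees the function only on \<open>H\<close>,
  and the comparison error is uniform in the starting point and linear in the Lipschitz constant.
  This single estimate gives integrability, the constant for induction, and the boundedness needed
  for uniqueness.\<close>

lemma integrable_measure_pmf_iff_summable:
  fixes f :: "'a \<Rightarrow> complex"
  assumes "set_pmf p \<subseteq> A"
  shows "integrable (measure_pmf p) f \<longleftrightarrow> (\<lambda>x. norm (of_real (pmf p x) * f x)) summable_on A"
proof -
  have "integrable (measure_pmf p) f \<longleftrightarrow> integrable (count_space UNIV) (\<lambda>x. of_real (pmf p x) * f x)"
    unfolding measure_pmf_eq_density by (subst integrable_density) (auto simp: scaleR_conv_of_real)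
  also have "\<dots> \<longleftrightarrow> (\<lambda>x. norm (of_real (pmf p x) * f x)) summable_on UNIV"
    by (simp add: abs_summable_equivalent Infinite_Set_Sum.abs_summable_on_def)
  also have "\<dots> \<longleftrightarrow> (\<lambda>x. norm (of_real (pmf p x) * f x)) summable_on A"
    using assms by (intro summable_on_cong_neutral) (auto simp: set_pmf_iff)
  finally show ?thesis .
qed

lemma integral_measure_pmf_eq_infsum:
  fixes f :: "'a \<Rightarrow> complex"
  assumes "set_pmf p \<subseteq> A" "integrable (measure_pmf p) f"
  shows "(LINT x|measure_pmf p. f x) = infsum (\<lambda>x. of_real (pmf p x) * f x) A"
proof -
  have int: "integrable (count_space UNIV) (\<lambda>x. of_real (pmf p x) * f x)"
    using assms(2) unfolding measure_pmf_eq_density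
    by (subst (asm) integrable_density) (auto simp: scaleR_conv_of_real)
  have "(LINT x|measure_pmf p. f x) = infsetsum (\<lambda>x. of_real (pmf p x) * f x) UNIV"
    unfolding measure_pmf_eq_density infsetsum_def
    by (subst integral_density) (auto simp: scaleR_conv_of_real)
  also have "\<dots> = infsum (\<lambda>x. of_real (pmf p x) * f x) UNIV"
    using int by (intro infsetsum_infsum) (simp add: Infinite_Set_Sum.abs_summable_on_def)
  also have "\<dots> = infsum (\<lambda>x. of_real (pmf p x) * f x) A"
    using assms by (intro infsum_cong_neutral) (auto simp: set_pmf_iff)
  finally show ?thesis .
qed

text \<open>Replaces the infinite sums of \<open>harmonic\<close> by Bochner integrals, for
  \<open>\<mu>\<close> on \<open>G\<close> as well as for the hitting law on \<open>H\<close> once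
  the latter is known to be a \<open>pmf\<close>.\<close>

lemma harmonic_pmf_iff:
  assumes "set_pmf p \<subseteq> carrier K"
  shows "harmonic K (pmf p) f \<longleftrightarrow>
    (\<forall>k\<in>carrier K. integrable (measure_pmf p) (\<lambda>g. f (k \<otimes>\<^bsub>K\<^esub> g)) \<and>
       f k = (LINT g|measure_pmf p. f (k \<otimes>\<^bsub>K\<^esub> g)))"
  unfolding harmonic_def
  by (simp add: integrable_measure_pmf_iff_summable[OF assms, symmetric]
      integral_measure_pmf_eq_infsum[OF assms] cong: conj_cong)

lemma pmf_has_sum_one:
  assumes "set_pmf p \<subseteq> A"
  shows "(pmf p has_sum 1) A"
proof -
  have s: "pmf p summable_on A"
    using abs_summable_equivalent[of "pmf p" A] pmf_abs_summable[of p A] by simp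
  have "infsum (pmf p) A = 1"
    using infsetsum_infsum[OF pmf_abs_summable[of p A]] infsetsum_pmf_eq_1[OF assms] by simp
  with s show ?thesis by (metis has_sum_infsum)
qed

text \<open>Tested on indicators, this is the first-step formula for nonnegative integrands. As an
  identity of measures it makes Fubini applicable to complex integrands.\<close>

lemma (in prob_space) stream_space_eq_distr_pair:
  "stream_space M = distr (M \<Otimes>\<^sub>M stream_space M) (stream_space M) (\<lambda>(x, \<omega>). x ## \<omega>)"
proof (rule measure_eqI)
  interpret W: prob_space "stream_space M" by (rule prob_space_stream_space)
  fix A assume A: "A \<in> sets (stream_space M)"
  have "emeasure (stream_space M) A = (\<integral>\<^sup>+\<omega>. indicator A \<omega> \<partial>stream_space M)"
    using A by simp
  also have "\<dots> = (\<integral>\<^sup>+x. \<integral>\<^sup>+\<omega>. indicator A (x ## \<omega>) \<partial>stream_space M \<partial>M)"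
    using A by (intro nn_integral_stream_space) simp
  also have "\<dots> = (\<integral>\<^sup>+z. indicator A (case z of (x, \<omega>) \<Rightarrow> x ## \<omega>) \<partial>(M \<Otimes>\<^sub>M stream_space M))"
    using A by (subst W.nn_integral_fst[symmetric]) (auto intro!: measurable_compose[where g="indicator A"])
  also have "\<dots> = (\<integral>\<^sup>+\<omega>. indicator A \<omega> \<partial>distr (M \<Otimes>\<^sub>M stream_space M) (stream_space M) (\<lambda>(x, \<omega>). x ## \<omega>))"
    using A by (subst nn_integral_distr) auto
  also have "\<dots> = emeasure (distr (M \<Otimes>\<^sub>M stream_space M) (stream_space M) (\<lambda>(x, \<omega>). x ## \<omega>)) A"
    using A by simp
  finally show "emeasure (stream_space M) A =
    emeasure (distr (M \<Otimes>\<^sub>M stream_space M) (stream_space M) (\<lambda>(x, \<omega>). x ## \<omega>)) A" .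
qed simp

lemma (in prob_space) integral_stream_space:
  fixes f :: "'a stream \<Rightarrow> 'b :: {banach, second_countable_topology}"
  assumes f: "integrable (stream_space M) f"
  shows "integrable M (\<lambda>x. LINT \<omega>|stream_space M. f (x ## \<omega>))" (is ?I)
    and "(LINT \<omega>|stream_space M. f \<omega>) = (LINT x|M. LINT \<omega>|stream_space M. f (x ## \<omega>))" (is ?E)
proof -
  interpret W: prob_space "stream_space M" by (rule prob_space_stream_space)
  interpret P: pair_sigma_finite M "stream_space M" ..
  have bm: "f \<in> borel_measurable (stream_space M)" using f by simp
  have i: "integrable (M \<Otimes>\<^sub>M stream_space M) (\<lambda>(x, \<omega>). f (x ## \<omega>))"
    using f bm by (subst (asm) stream_space_eq_distr_pair, subst (asm) integrable_distr_eq)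
      (auto simp: case_prod_unfold)
  show ?I using P.integrable_fst'[OF i] by simp
  have "(LINT \<omega>|stream_space M. f \<omega>) = (LINT z|(M \<Otimes>\<^sub>M stream_space M). (\<lambda>(x, \<omega>). f (x ## \<omega>)) z)"
    using bm by (subst stream_space_eq_distr_pair, subst integral_distr) (auto simp: case_prod_unfold)
  also have "\<dots> = (LINT x|M. LINT \<omega>|stream_space M. f (x ## \<omega>))"
    using P.integral_fst'[OF i] by simp
  finally show ?E .
qed

section \<open>Words and Lipschitz functions\<close>

lemma grad_norm_le_iff:
  assumes "0 \<le> L"
  shows "grad_norm K S f \<le> ennreal L \<longleftrightarrow> (\<forall>s\<in>S. \<forall>x\<in>carrier K. cmod (f (x \<otimes>\<^bsub>K\<^esub> s) - f x) \<le> L)"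
  using assms by (auto simp: grad_norm_def SUP_le_iff ennreal_le_iff)

lemma grad_norm_finiteE:
  assumes "grad_norm K S f < \<infinity>"
  obtains L where "0 \<le> L" "grad_norm K S f = ennreal L"
    "\<And>s x. s \<in> S \<Longrightarrow> x \<in> carrier K \<Longrightarrow> cmod (f (x \<otimes>\<^bsub>K\<^esub> s) - f x) \<le> L"
proof -
  obtain L where L: "0 \<le> L" "grad_norm K S f = ennreal L"
    using assms by (cases "grad_norm K S f") auto
  then show ?thesis using that[of L] grad_norm_le_iff[of L K S f] by auto
qed

lemma LHF_lipschitzE:
  assumes "f \<in> LHF K S m"
  obtains L where "0 \<le> L" "grad_norm K S f = ennreal L"
    "\<And>s x. s \<in> S \<Longrightarrow> x \<in> carrier K \<Longrightarrow> cmod (f (x \<otimes>\<^bsub>K\<^esub> s) - f x) \<le> L"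
proof (rule grad_norm_finiteE)
  show "grad_norm K S f < \<infinity>" using assms by (simp add: LHF_def)
qed (rule that)

text \<open>The mass function \<open>m\<close> is arbitrary, so one proof serves
  \<open>\<mu>\<close> on \<open>G\<close> and the hitting law on \<open>H\<close>. Absolute
  convergence for a sum of functions comes from comparison with the sum of the norms.\<close>

lemma LHF_function_subspace:
  assumes "group K" "S \<subseteq> carrier K"
  shows "function_subspace (carrier K) (LHF K S m)"
  unfolding function_subspace_def
proof (intro conjI ballI allI)
  interpret group K by fact
  show "LHF K S m \<subseteq> extensional (carrier K)" by (auto simp: LHF_def)
  have S: "s \<in> carrier K" if "s \<in> S" for s using assms that by auto
  have "grad_norm K S (\<lambda>x\<in>carrier K. 0) \<le> ennreal 0"
    by (subst grad_norm_le_iff) (auto simp: S)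
  then show "(\<lambda>x\<in>carrier K. 0) \<in> LHF K S m"
    by (auto simp: LHF_def harmonic_def intro!: summable_on_0 infsum_0)
next
  interpret group K by fact
  have S: "s \<in> carrier K" if "s \<in> S" for s using assms that by auto
  fix f g assume f: "f \<in> LHF K S m" and g: "g \<in> LHF K S m"
  obtain L where L: "0 \<le> L"
    "\<And>s x. s \<in> S \<Longrightarrow> x \<in> carrier K \<Longrightarrow> cmod (f (x \<otimes>\<^bsub>K\<^esub> s) - f x) \<le> L"
    using f by (rule LHF_lipschitzE) blast
  obtain L' where L': "0 \<le> L'"
    "\<And>s x. s \<in> S \<Longrightarrow> x \<in> carrier K \<Longrightarrow> cmod (g (x \<otimes>\<^bsub>K\<^esub> s) - g x) \<le> L'"
    using g by (rule LHF_lipschitzE) blast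
  have "grad_norm K S (\<lambda>x\<in>carrier K. f x + g x) \<le> ennreal (L + L')"
  proof (subst grad_norm_le_iff, use L L' in simp, intro ballI)
    fix s x assume sx: "s \<in> S" "x \<in> carrier K"
    have "cmod ((f (x \<otimes>\<^bsub>K\<^esub> s) - f x) + (g (x \<otimes>\<^bsub>K\<^esub> s) - g x)) \<le> L + L'"
      using L(2)[OF sx] L'(2)[OF sx] by (intro norm_triangle_mono)
    then show "cmod ((\<lambda>x\<in>carrier K. f x + g x) (x \<otimes>\<^bsub>K\<^esub> s) - (\<lambda>x\<in>carrier K. f x + g x) x) \<le> L + L'"
      using sx S by (simp add: algebra_simps)
  qed
  then have gr: "grad_norm K S (\<lambda>x\<in>carrier K. f x + g x) < \<infinity>"
    using le_less_trans by fastforce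
  have "harmonic K m (\<lambda>x\<in>carrier K. f x + g x)"
    unfolding harmonic_def
  proof (intro ballI conjI)
    fix k assume k: "k \<in> carrier K"
    let ?F = "\<lambda>h. of_real (m h) * f (k \<otimes>\<^bsub>K\<^esub> h)" and ?G = "\<lambda>h. of_real (m h) * g (k \<otimes>\<^bsub>K\<^esub> h)"
    have F: "(\<lambda>h. norm (?F h)) summable_on carrier K" "f k = infsum ?F (carrier K)"
      using f k by (auto simp: LHF_def harmonic_def)
    have G: "(\<lambda>h. norm (?G h)) summable_on carrier K" "g k = infsum ?G (carrier K)"
      using g k by (auto simp: LHF_def harmonic_def)
    have eq: "of_real (m h) * (\<lambda>x\<in>carrier K. f x + g x) (k \<otimes>\<^bsub>K\<^esub> h) = ?F h + ?G h"
      if "h \<in> carrier K" for h using that k by (simp add: algebra_simps)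
    have "(\<lambda>h. norm (?F h + ?G h)) summable_on carrier K"
      by (rule summable_on_comparison_test[OF summable_on_add[OF F(1) G(1)]])
        (auto simp: norm_triangle_ineq)
    then show "(\<lambda>h. norm (of_real (m h) * (\<lambda>x\<in>carrier K. f x + g x) (k \<otimes>\<^bsub>K\<^esub> h))) summable_on carrier K"
      by (subst summable_on_cong[where g="\<lambda>h. norm (?F h + ?G h)"]) (simp_all only: eq)
    have "infsum (\<lambda>h. ?F h + ?G h) (carrier K) = f k + g k"
      using infsum_add[OF abs_summable_summable[OF F(1)] abs_summable_summable[OF G(1)]] F(2) G(2)
      by simp
    then show "(\<lambda>x\<in>carrier K. f x + g x) k =
        infsum (\<lambda>h. of_real (m h) * (\<lambda>x\<in>carrier K. f x + g x) (k \<otimes>\<^bsub>K\<^esub> h)) (carrier K)"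
      using k by (subst infsum_cong[where g="\<lambda>h. ?F h + ?G h"]) (simp_all only: eq restrict_apply')
  qed
  with gr show "(\<lambda>x\<in>carrier K. f x + g x) \<in> LHF K S m" by (simp add: LHF_def)
next
  interpret group K by fact
  have S: "s \<in> carrier K" if "s \<in> S" for s using assms that by auto
  fix c f assume f: "f \<in> LHF K S m"
  obtain L where L: "0 \<le> L"
    "\<And>s x. s \<in> S \<Longrightarrow> x \<in> carrier K \<Longrightarrow> cmod (f (x \<otimes>\<^bsub>K\<^esub> s) - f x) \<le> L"
    using f by (rule LHF_lipschitzE) blast
  have "grad_norm K S (\<lambda>x\<in>carrier K. c * f x) \<le> ennreal (cmod c * L)"
    using L S by (subst grad_norm_le_iff)
      (auto simp: right_diff_distrib[symmetric] norm_mult mult_left_mono)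
  then have gr: "grad_norm K S (\<lambda>x\<in>carrier K. c * f x) < \<infinity>"
    using le_less_trans by fastforce
  have "harmonic K m (\<lambda>x\<in>carrier K. c * f x)"
    unfolding harmonic_def
  proof (intro ballI conjI)
    fix k assume k: "k \<in> carrier K"
    let ?F = "\<lambda>h. of_real (m h) * f (k \<otimes>\<^bsub>K\<^esub> h)"
    have F: "(\<lambda>h. norm (?F h)) summable_on carrier K" "f k = infsum ?F (carrier K)"
      using f k by (auto simp: LHF_def harmonic_def)
    have eq: "of_real (m h) * (\<lambda>x\<in>carrier K. c * f x) (k \<otimes>\<^bsub>K\<^esub> h) = c * ?F h"
      if "h \<in> carrier K" for h using that k by (simp add: algebra_simps)
    have "(\<lambda>h. cmod c * norm (?F h)) summable_on carrier K"
      using F(1) by (rule summable_on_cmult_right)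
    then show "(\<lambda>h. norm (of_real (m h) * (\<lambda>x\<in>carrier K. c * f x) (k \<otimes>\<^bsub>K\<^esub> h))) summable_on carrier K"
      by (subst summable_on_cong[where g="\<lambda>h. cmod c * norm (?F h)"]) (simp_all only: eq norm_mult)
    have "infsum (\<lambda>h. c * ?F h) (carrier K) = c * f k"
      using infsum_cmult_right'[of c ?F "carrier K"] F(2) by simp
    then show "(\<lambda>x\<in>carrier K. c * f x) k =
        infsum (\<lambda>h. of_real (m h) * (\<lambda>x\<in>carrier K. c * f x) (k \<otimes>\<^bsub>K\<^esub> h)) (carrier K)"
      using k by (subst infsum_cong[where g="\<lambda>h. c * ?F h"]) (simp_all only: eq restrict_apply')
  qed
  with gr show "(\<lambda>x\<in>carrier K. c * f x) \<in> LHF K S m" by (simp add: LHF_def)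
qed

section \<open>Words in the generators, countability, Lipschitz bounds along words\<close>

context group
begin

abbreviation word_prod :: "'a list \<Rightarrow> 'a" where
  "word_prod w \<equiv> foldr (\<lambda>s y. s \<otimes> y) w \<one>"

lemma word_prod_closed: "set w \<subseteq> carrier G \<Longrightarrow> word_prod w \<in> carrier G"
  by (induction w) auto

lemma word_prod_append:
  "set v \<subseteq> carrier G \<Longrightarrow> set w \<subseteq> carrier G \<Longrightarrow> word_prod (v @ w) = word_prod v \<otimes> word_prod w"
  by (induction v) (auto simp: word_prod_closed m_assoc)

text \<open>\<open>generate\<close> admits inverses of generators; symmetry of \<open>S\<close>
  turns each of them into a letter, so plain words suffice.\<close>

lemma ex_word:
  assumes "fin_sym_gen G S" "x \<in> carrier G"
  shows "\<exists>w. set w \<subseteq> S \<and> word_prod w = x"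
proof -
  have S: "S \<subseteq> carrier G" "\<And>s. s \<in> S \<Longrightarrow> inv s \<in> S" "x \<in> generate G S"
    using assms by (auto simp: fin_sym_gen_def)
  from S(3) show ?thesis
  proof induction
    case one then show ?case by (intro exI[of _ "[]"]) simp
  next
    case (incl h) then show ?case using S by (intro exI[of _ "[h]"]) auto
  next
    case (inv h) then show ?case using S by (intro exI[of _ "[inv h]"]) auto
  next
    case (eng h1 h2)
    then obtain v w where "set v \<subseteq> S" "word_prod v = h1" "set w \<subseteq> S" "word_prod w = h2" by auto
    then show ?case using S(1) by (intro exI[of _ "v @ w"]) (auto simp: word_prod_append simp del: foldr_append)
  qed
qed

text \<open>Needed for measurability: statements about the random position of the walk are split
  over its countably many values. It also makes the hitting law discrete.\<close>

lemma countable_carrier: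
  assumes "fin_sym_gen G S"
  shows "countable (carrier G)"
proof (rule countable_subset)
  show "carrier G \<subseteq> word_prod ` lists S" using ex_word[OF assms] by (fastforce simp: in_lists_conv_set)
  show "countable (word_prod ` lists S)"
    using assms by (auto simp: fin_sym_gen_def countable_finite)
qed

text \<open>The prefixes of the word give a path from \<open>x\<close> by right multiplications,
  each edge costing at most \<open>L\<close>. Peeling off the first letter moves the base point,
  hence the induction over arbitrary \<open>x\<close>.\<close>

lemma lipschitz_word:
  assumes "S \<subseteq> carrier G" "set w \<subseteq> S" "x \<in> carrier G"
    and "\<And>s x. s \<in> S \<Longrightarrow> x \<in> carrier G \<Longrightarrow> cmod (f (x \<otimes> s) - f x) \<le> L"
  shows "cmod (f (x \<otimes> word_prod w) - f x) \<le> L * real (length w)"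
  using assms(2,3)
proof (induction w arbitrary: x)
  case (Cons s w)
  have s: "s \<in> S" "s \<in> carrier G" "word_prod w \<in> carrier G"
    using Cons.prems assms(1) by (auto intro!: word_prod_closed)
  have "cmod (f ((x \<otimes> s) \<otimes> word_prod w) - f (x \<otimes> s)) \<le> L * real (length w)"
    using Cons s by auto
  moreover have "cmod (f (x \<otimes> s) - f x) \<le> L" using assms(4) s Cons.prems by auto
  ultimately have "cmod ((f ((x \<otimes> s) \<otimes> word_prod w) - f (x \<otimes> s)) + (f (x \<otimes> s) - f x)) \<le> L * real (length w) + L"
    by (rule norm_triangle_mono)
  then show ?case using Cons.prems s by (simp add: m_assoc algebra_simps)
qed simp

lemma lipschitz_word_length:
  assumes "fin_sym_gen G S" "x \<in> carrier G" "g \<in> carrier G"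
    and "\<And>s x. s \<in> S \<Longrightarrow> x \<in> carrier G \<Longrightarrow> cmod (f (x \<otimes> s) - f x) \<le> L"
  shows "cmod (f (x \<otimes> g) - f x) \<le> L * real (word_length G S g)"
proof -
  let ?P = "\<lambda>n. \<exists>w. length w = n \<and> set w \<subseteq> S \<and> word_prod w = g"
  have "?P (word_length G S g)"
    unfolding word_length_def using ex_word[OF assms(1,3)] by - (rule LeastI_ex[where P = ?P], auto)
  then obtain w where w: "length w = word_length G S g" "set w \<subseteq> S" "word_prod w = g" by auto
  have "S \<subseteq> carrier G" using assms(1) by (simp add: fin_sym_gen_def)
  from lipschitz_word[OF this w(2) assms(2,4)] w show ?thesis by simp
qed

text \<open>The constant does not depend on the function, so that finitely many translations
  can be treated at once.\<close>

lemma lipschitz_finite_set: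
  assumes "fin_sym_gen G S" "finite Z" "Z \<subseteq> carrier G"
  obtains c where "0 < c" "\<And>f L z x. z \<in> Z \<Longrightarrow> x \<in> carrier G \<Longrightarrow> 0 \<le> L \<Longrightarrow>
    (\<And>s x. s \<in> S \<Longrightarrow> x \<in> carrier G \<Longrightarrow> cmod (f (x \<otimes> s) - f x) \<le> L) \<Longrightarrow>
    cmod (f (x \<otimes> z) - f x) \<le> c * L"
proof
  \<comment> \<open>The sum dominates the length of each element of \<open>Z\<close>; the summand 1
    keeps the constant positive even if all these lengths vanish or \<open>Z\<close> is
    empty.\<close>
  let ?c = "1 + (\<Sum>z\<in>Z. real (word_length G S z))"
  show "0 < ?c" by (smt (verit) of_nat_0_le_iff sum_nonneg)
  fix f :: "'a \<Rightarrow> complex" and L :: real and z x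
  assume a: "z \<in> Z" "x \<in> carrier G" "0 \<le> L"
    "\<And>s x. s \<in> S \<Longrightarrow> x \<in> carrier G \<Longrightarrow> cmod (f (x \<otimes> s) - f x) \<le> L"
  have "cmod (f (x \<otimes> z) - f x) \<le> L * real (word_length G S z)"
    using assms a by (intro lipschitz_word_length) auto
  also have "\<dots> \<le> L * ?c"
    using member_le_sum[OF a(1), of "\<lambda>z. real (word_length G S z)"] assms(2) a(3)
    by (intro mult_left_mono) auto
  finally show "cmod (f (x \<otimes> z) - f x) \<le> ?c * L" by (simp add: mult.commute)
qed

section \<open>Finite-index subgroups\<close>

text \<open>\<open>r\<close> picks one representative in each right coset of \<open>H\<close>. The
  normalisation to the identity on \<open>H\<close> itself is what later makes the Lipschitz
  extension agree with the original function on \<open>H\<close>.\<close>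

lemma finite_transversal:
  assumes "subgroup H G" "finite (rcosets H)"
  shows "\<exists>r. (\<forall>x\<in>carrier G. r x \<in> carrier G) \<and> (\<forall>x\<in>carrier G. x \<otimes> inv (r x) \<in> H) \<and>
    (\<forall>h\<in>H. \<forall>x\<in>carrier G. r (h \<otimes> x) = r x) \<and> (\<forall>x\<in>H. r x = \<one>) \<and> finite (r ` carrier G)"
proof -
  interpret H: subgroup H G by fact
  let ?rep = "\<lambda>C. if C = H then \<one> else SOME y. y \<in> C"
  let ?r = "\<lambda>x. ?rep (H #> x)"
  have mem: "?r x \<in> H #> x" if "x \<in> carrier G" for x
    using rcos_self[OF that assms(1)] by (auto intro: someI[of "\<lambda>y. y \<in> H #> x" x])
  have c: "?r x \<in> carrier G" if "x \<in> carrier G" for x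
    using mem[OF that] r_coset_subset_G[OF H.subset that] by blast
  have i: "x \<otimes> inv (?r x) \<in> H" if x: "x \<in> carrier G" for x
  proof -
    have "\<exists>h\<in>H. y = h \<otimes> x" if "y \<in> H #> x" for y using that by (auto simp: r_coset_def)
    from this[OF mem[OF x]] obtain h where h: "h \<in> H" "?r x = h \<otimes> x" by blast
    have "x \<otimes> inv (h \<otimes> x) = inv h" using h(1) x
      by (simp add: inv_mult_group m_assoc[symmetric])
    then show ?thesis unfolding h(2) using h(1) by simp
  qed
  have t: "?r (h \<otimes> x) = ?r x" if "h \<in> H" "x \<in> carrier G" for h x
    using that by (simp add: coset_mult_assoc[symmetric] coset_join2[OF _ assms(1)] H.subset)
  have o: "?r x = \<one>" if "x \<in> H" for x
    using that by (simp add: coset_join2[OF _ assms(1)])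
  have "?r ` carrier G = ?rep ` (rcosets H)" by (auto simp: RCOSETS_def)
  then have f: "finite (?r ` carrier G)" using assms(2) by simp
  show ?thesis by (rule exI[of _ ?r]) (intro conjI ballI c i t o f)
qed

text \<open>Schreier's lemma. The set \<open>Z\<close> allows an arbitrary transversal element
  \<open>t'\<close> with \<open>t \<otimes> s \<otimes> inv t'\<close> in \<open>H\<close>, not only
  the representative of \<open>t \<otimes> s\<close>; then inversion merely exchanges the roles of
  \<open>t\<close> and \<open>t'\<close>, and \<open>Z\<close> is visibly symmetric.\<close>

lemma schreier_generators:
  assumes gen: "fin_sym_gen G S" and "subgroup H G" "finite (rcosets H)"
  shows "\<exists>S\<^sub>H. fin_sym_gen (G\<lparr>carrier := H\<rparr>) S\<^sub>H"
proof -
  interpret H: subgroup H G by fact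
  have S: "finite S" "S \<subseteq> carrier G" "\<And>s. s \<in> S \<Longrightarrow> inv s \<in> S" "generate G S = carrier G"
    using gen by (auto simp: fin_sym_gen_def)
  obtain r where R: "\<forall>x\<in>carrier G. r x \<in> carrier G" "\<forall>x\<in>carrier G. x \<otimes> inv (r x) \<in> H"
    "\<forall>h\<in>H. \<forall>x\<in>carrier G. r (h \<otimes> x) = r x" "\<forall>x\<in>H. r x = \<one>" "finite (r ` carrier G)"
    using finite_transversal[OF assms(2,3)] by (elim exE conjE)
  note r = bspec[OF R(1)] bspec[OF R(2)] bspec[OF bspec[OF R(3)]] bspec[OF R(4)] R(5)

  define T where "T = r ` carrier G"
  define Z where "Z = ((\<lambda>(t, s, t'). t \<otimes> s \<otimes> inv t') ` (T \<times> S \<times> T)) \<inter> H"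
  have T: "t \<in> carrier G" if "t \<in> T" for t using r that by (auto simp: T_def)
  have fin: "finite Z" using S r by (auto simp: Z_def T_def)
  have ZH: "Z \<subseteq> H" by (auto simp: Z_def)
  have ZI: "t \<otimes> s \<otimes> inv t' \<in> Z" if "t \<in> T" "s \<in> S" "t' \<in> T" "t \<otimes> s \<otimes> inv t' \<in> H" for t s t'
    using that imageI[of "(t, s, t')" "T \<times> S \<times> T" "\<lambda>(t, s, t'). t \<otimes> s \<otimes> inv t'"] by (simp add: Z_def)
  have sym: "inv z \<in> Z" if zZ: "z \<in> Z" for z
  proof -
    obtain p where p: "p \<in> T \<times> S \<times> T" "z = (\<lambda>(t, s, t'). t \<otimes> s \<otimes> inv t') p" "z \<in> H"
      using zZ unfolding Z_def by blast
    obtain t s t' where "p = (t, s, t')" by (cases p)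
    with p have z: "z = t \<otimes> s \<otimes> inv t'" "t \<in> T" "s \<in> S" "t' \<in> T" "z \<in> H"
      by simp_all
    have "inv z = t' \<otimes> inv s \<otimes> inv t"
      using z S T by (auto simp: inv_mult_group m_assoc subset_iff)
    then show ?thesis using ZI[of t' "inv s" t] H.m_inv_closed[OF z(5)] z S(3) by simp
  qed
  \<comment> \<open>Pushing a group element through a transversal element from the right leaves a
    factor generated by \<open>Z\<close> on the left and a new transversal element. For an element
    of \<open>H\<close>, started at the identity, that last transversal element must be
    trivial.\<close>
  have move: "\<forall>t\<in>T. \<exists>t'\<in>T. \<exists>k\<in>generate G Z. t \<otimes> x = k \<otimes> t'" if "x \<in> generate G S" for x
    using that
  proof induction
    case one
    have "t \<otimes> \<one> = \<one> \<otimes> t" if "t \<in> T" for t using T[OF that] by simp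
    then show ?case using generate.one by blast
  next
    have key: "\<exists>t'\<in>T. \<exists>k\<in>generate G Z. t \<otimes> s = k \<otimes> t'" if "t \<in> T" "s \<in> S" for t s
    proof (intro bexI)
      have c: "t \<in> carrier G" "s \<in> carrier G" using that T S by auto
      then show t': "r (t \<otimes> s) \<in> T" by (auto simp: T_def)
      show "t \<otimes> s = (t \<otimes> s \<otimes> inv (r (t \<otimes> s))) \<otimes> r (t \<otimes> s)"
        using c r(1) by (simp add: m_assoc)
      have "t \<otimes> s \<otimes> inv (r (t \<otimes> s)) \<in> H" using r(2)[of "t \<otimes> s"] c by simp
      then have "t \<otimes> s \<otimes> inv (r (t \<otimes> s)) \<in> Z" by (intro ZI that t')
      then show "t \<otimes> s \<otimes> inv (r (t \<otimes> s)) \<in> generate G Z" by (rule generate.incl)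
    qed
    case (incl s) show ?case by (intro ballI key incl)
    case (inv s) show ?case by (intro ballI key S(3) inv)
  next
    case (eng x y)
    show ?case
    proof
      fix t assume t: "t \<in> T"
      obtain t' k where 1: "t' \<in> T" "k \<in> generate G Z" "t \<otimes> x = k \<otimes> t'" using eng t by blast
      obtain t'' k' where 2: "t'' \<in> T" "k' \<in> generate G Z" "t' \<otimes> y = k' \<otimes> t''" using eng 1 by blast
      have g: "generate G Z \<subseteq> carrier G" using ZH H.subset by (intro generate_incl) auto
      have c: "x \<in> carrier G" "y \<in> carrier G" "t \<in> carrier G" "t' \<in> carrier G" "t'' \<in> carrier G"
        "k \<in> carrier G" "k' \<in> carrier G"
        using eng.hyps S(4) T[OF t] T[OF 1(1)] T[OF 2(1)] subsetD[OF g 1(2)] subsetD[OF g 2(2)]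
        by simp_all
      have "t \<otimes> (x \<otimes> y) = (k \<otimes> t') \<otimes> y" using c by (simp add: m_assoc[symmetric] 1(3))
      also have "\<dots> = (k \<otimes> k') \<otimes> t''" using c by (simp add: m_assoc 2(3))
      finally show "\<exists>t'\<in>T. \<exists>k\<in>generate G Z. t \<otimes> (x \<otimes> y) = k \<otimes> t'"
        using 2(1) generate.eng[OF 1(2) 2(2)] by blast
    qed
  qed
  have "generate G Z = H"
  proof
    show gH: "generate G Z \<subseteq> H" using generate_subgroup_incl[OF ZH assms(2)] .
    show "H \<subseteq> generate G Z"
    proof
      fix h assume h: "h \<in> H"
      have oneT: "\<one> \<in> T" using r(4)[of \<one>] H.one_closed unfolding T_def by (metis image_eqI one_closed)
      have "\<exists>t'\<in>T. \<exists>k\<in>generate G Z. \<one> \<otimes> h = k \<otimes> t'"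
        by (rule bspec[OF move oneT]) (use h S(4) in simp)
      then obtain t' k where k: "t' \<in> T" "k \<in> generate G Z" "\<one> \<otimes> h = k \<otimes> t'" by blast
      obtain y where y: "y \<in> carrier G" "t' = r y" using k by (auto simp: T_def)
      have kH: "k \<in> H" using k gH by auto
      have "h = k \<otimes> t'" using k(3) h by simp
      then have "t' = inv k \<otimes> h" using kH T[OF k(1)] by (simp add: m_assoc[symmetric])
      then have tH: "t' \<in> H" using kH h by simp
      \<comment> \<open>\<open>t'\<close> differs from \<open>y\<close> by the left factor
        \<open>inv (y \<otimes> inv (r y))\<close>, which lies in \<open>H\<close>, and
        \<open>r\<close> is constant on right cosets.\<close>
      have "r t' = t'" using r(3)[OF H.m_inv_closed[OF r(2)[OF y(1)]] y(1)] y r(1)[OF y(1)]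
        by (simp add: inv_mult_group m_assoc)
      then have "t' = \<one>" using r(4)[OF tH] by simp
      with \<open>h = k \<otimes> t'\<close> show "h \<in> generate G Z" using k(2) kH by simp
    qed
  qed
  then have "generate (G\<lparr>carrier := H\<rparr>) Z = H"
    using generate_consistent[OF ZH assms(2)] by simp
  moreover have "inv\<^bsub>G\<lparr>carrier := H\<rparr>\<^esub> z \<in> Z" if "z \<in> Z" for z
    using sym[OF that] that m_inv_consistent[OF assms(2)] ZH by auto
  ultimately have "fin_sym_gen (G\<lparr>carrier := H\<rparr>) Z"
    using fin ZH unfolding fin_sym_gen_def by auto
  then show ?thesis by blast
qed

text \<open>Write \<open>x = h \<otimes> t\<close> with \<open>t = r x\<close> and put
  \<open>F x = f h\<close>. If \<open>t'\<close> represents the coset of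
  \<open>x \<otimes> s\<close>, the \<open>H\<close>-part of \<open>x \<otimes> s\<close> is
  \<open>h \<otimes> (t \<otimes> s \<otimes> inv t')\<close>: one step in \<open>G\<close> moves
  the \<open>H\<close>-part by an element of a finite set of Schreier elements. The constant
  \<open>c\<close> bounds the effect of those, so it is chosen before \<open>f\<close>.\<close>

lemma lipschitz_extension:
  assumes gen: "fin_sym_gen G S" and "subgroup H G" "finite (rcosets H)"
    and genH: "fin_sym_gen (G\<lparr>carrier := H\<rparr>) S\<^sub>H"
  obtains c where "0 < c" "\<And>f L. 0 \<le> L \<Longrightarrow>
    (\<And>s x. s \<in> S\<^sub>H \<Longrightarrow> x \<in> H \<Longrightarrow> cmod (f (x \<otimes> s) - f x) \<le> L) \<Longrightarrow>
    \<exists>F. (\<forall>x\<in>H. F x = f x) \<and> (\<forall>s\<in>S. \<forall>x\<in>carrier G. cmod (F (x \<otimes> s) - F x) \<le> c * L)"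
proof -
  interpret H: subgroup H G by fact
  interpret HG: group "G\<lparr>carrier := H\<rparr>" by (rule subgroup_imp_group) fact
  have S: "finite S" "S \<subseteq> carrier G" using gen by (auto simp: fin_sym_gen_def)
  obtain r where R: "\<forall>x\<in>carrier G. r x \<in> carrier G" "\<forall>x\<in>carrier G. x \<otimes> inv (r x) \<in> H"
    "\<forall>h\<in>H. \<forall>x\<in>carrier G. r (h \<otimes> x) = r x" "\<forall>x\<in>H. r x = \<one>" "finite (r ` carrier G)"
    using finite_transversal[OF assms(2,3)] by (elim exE conjE)
  note r = bspec[OF R(1)] bspec[OF R(2)] bspec[OF bspec[OF R(3)]] bspec[OF R(4)] R(5)

  define T where "T = r ` carrier G"
  define Z where "Z = ((\<lambda>(t, s, t'). t \<otimes> s \<otimes> inv t') ` (T \<times> S \<times> T)) \<inter> H"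
  have fin: "finite Z" using S r by (auto simp: Z_def T_def)
  have ZH: "Z \<subseteq> H" by (auto simp: Z_def)
  have ZI: "t \<otimes> s \<otimes> inv t' \<in> Z" if "t \<in> T" "s \<in> S" "t' \<in> T" "t \<otimes> s \<otimes> inv t' \<in> H" for t s t'
    using that imageI[of "(t, s, t')" "T \<times> S \<times> T" "\<lambda>(t, s, t'). t \<otimes> s \<otimes> inv t'"] by (simp add: Z_def)
  obtain c where c: "0 < c" "\<And>f L z x. z \<in> Z \<Longrightarrow> x \<in> H \<Longrightarrow> 0 \<le> L \<Longrightarrow>
    (\<And>s x. s \<in> S\<^sub>H \<Longrightarrow> x \<in> H \<Longrightarrow> cmod (f (x \<otimes> s) - f x) \<le> L) \<Longrightarrow>
    cmod (f (x \<otimes> z) - f x) \<le> c * L"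
    using HG.lipschitz_finite_set[OF genH fin] ZH by auto
  show thesis
  proof (rule that[OF c(1)])
    fix f :: "'a \<Rightarrow> complex" and L :: real
    assume L: "0 \<le> L" "\<And>s x. s \<in> S\<^sub>H \<Longrightarrow> x \<in> H \<Longrightarrow> cmod (f (x \<otimes> s) - f x) \<le> L"
    let ?F = "\<lambda>x. f (x \<otimes> inv (r x))"
    have "?F x = f x" if "x \<in> H" for x using that r(4) by simp
    moreover have "cmod (?F (x \<otimes> s) - ?F x) \<le> c * L" if sx: "s \<in> S" "x \<in> carrier G" for s x
    proof -
      define t where "t = r x"
      define h where "h = x \<otimes> inv t"
      define t' where "t' = r (x \<otimes> s)"
      have cs: "s \<in> carrier G" "t \<in> carrier G" "t' \<in> carrier G" "h \<in> carrier G"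
        using sx S r(1) by (auto simp: t_def t'_def h_def)
      have h: "h \<in> H" using r(2) sx by (simp add: h_def t_def)
      have x: "x = h \<otimes> t" using sx cs by (simp add: h_def m_assoc)
      have z: "t \<otimes> s \<otimes> inv t' \<in> H"
      proof -
        have "x \<otimes> s \<otimes> inv t' \<in> H" using r(2)[of "x \<otimes> s"] sx cs by (simp add: t'_def)
        then have "inv h \<otimes> (x \<otimes> s \<otimes> inv t') \<in> H" using h by simp
        moreover have "inv h \<otimes> (x \<otimes> s \<otimes> inv t') = t \<otimes> s \<otimes> inv t'"
          unfolding x using cs by (simp add: m_assoc[symmetric])
        ultimately show ?thesis by simp
      qed
      have zZ: "t \<otimes> s \<otimes> inv t' \<in> Z"
        by (rule ZI[OF _ _ _ z]) (use sx cs in \<open>auto simp: t_def t'_def T_def\<close>)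
      have "cmod (f (h \<otimes> (t \<otimes> s \<otimes> inv t')) - f h) \<le> c * L"
        using zZ h L by (rule c(2))
      moreover have "h \<otimes> (t \<otimes> s \<otimes> inv t') = x \<otimes> s \<otimes> inv t'"
        unfolding x using cs by (simp add: m_assoc)
      ultimately show ?thesis by (simp add: h_def t_def t'_def)
    qed
    ultimately show "\<exists>F. (\<forall>x\<in>H. F x = f x) \<and> (\<forall>s\<in>S. \<forall>x\<in>carrier G. cmod (F (x \<otimes> s) - F x) \<le> c * L)"
      by (intro exI[of _ ?F] conjI ballI)
  qed
qed

end

section \<open>Hitting times of the walk\<close>

lemma hitting_time_eq_Least:
  assumes "t0 \<le> t" "X t \<in> H"
  shows "hitting_time t0 H X = enat (LEAST t. t0 \<le> t \<and> X t \<in> H)"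
  unfolding hitting_time_def
proof (rule antisym)
  let ?l = "LEAST t. t0 \<le> t \<and> X t \<in> H"
  have "t0 \<le> ?l \<and> X ?l \<in> H" using assms LeastI[of "\<lambda>t. t0 \<le> t \<and> X t \<in> H" t] by auto
  then show "Inf (enat ` {t. t0 \<le> t \<and> X t \<in> H}) \<le> enat ?l" by (intro Inf_lower) auto
  show "enat ?l \<le> Inf (enat ` {t. t0 \<le> t \<and> X t \<in> H})"
    by (intro Inf_greatest) (auto intro: Least_le)
qed

lemma hitting_time_finite_iff: "hitting_time t0 H X < \<infinity> \<longleftrightarrow> (\<exists>t\<ge>t0. X t \<in> H)"
proof
  assume a: "hitting_time t0 H X < \<infinity>"
  show "\<exists>t\<ge>t0. X t \<in> H"
  proof (rule ccontr)
    assume "\<not> (\<exists>t\<ge>t0. X t \<in> H)"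
    then have "{t. t0 \<le> t \<and> X t \<in> H} = {}" by auto
    then show False using a by (simp add: hitting_time_def Inf_enat_def)
  qed
qed (auto simp: hitting_time_eq_Least)

lemma walk_Stream: "walk G x (g ## \<omega>) (Suc t) = walk G (x \<otimes>\<^bsub>G\<^esub> g) \<omega> t"
  by (induction t) auto

text \<open>With \<open>LEAST\<close> in place of an infimum in \<open>enat\<close>, measurability
  and the shift by one step reduce to standard facts on natural numbers.\<close>

lemma stopped_value_eq:
  "stopped_value G H f x \<omega> = (if \<exists>t. walk G x \<omega> t \<in> H
     then f (walk G x \<omega> (LEAST t. walk G x \<omega> t \<in> H)) else 0)"
proof (cases "\<exists>t. walk G x \<omega> t \<in> H")
  case True
  then obtain t where "walk G x \<omega> t \<in> H" by blast
  then have "hitting_time 0 H (walk G x \<omega>) = enat (LEAST t. walk G x \<omega> t \<in> H)"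
    using hitting_time_eq_Least[of 0 t "walk G x \<omega>" H] by simp
  with True show ?thesis by (simp add: stopped_value_def Let_def)
next
  case False
  then have "\<not> hitting_time 0 H (walk G x \<omega>) < \<infinity>" by (simp only: hitting_time_finite_iff) simp
  with False show ?thesis by (simp only: stopped_value_def Let_def if_False)
qed

lemma stopped_value_in: "x \<in> H \<Longrightarrow> stopped_value G H f x \<omega> = f x"
proof -
  assume x: "x \<in> H"
  then have least: "(LEAST t. walk G x \<omega> t \<in> H) = 0" by (intro Least_equality) auto
  have "\<exists>t. walk G x \<omega> t \<in> H" using x by (intro exI[of _ 0]) simp
  then show ?thesis by (simp add: stopped_value_eq least)
qed

text \<open>Off \<open>H\<close> the hit cannot occur at time 0, so dropping the first increment
  lowers the hitting time by one and keeps the point hit. The identity holds on every path: without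
  a hit both sides take the default 0.\<close>

lemma stopped_value_Stream:
  assumes "x \<notin> H"
  shows "stopped_value G H f x (g ## \<omega>) = stopped_value G H f (x \<otimes>\<^bsub>G\<^esub> g) \<omega>"
proof -
  have ex: "(\<exists>t. walk G x (g ## \<omega>) t \<in> H) \<longleftrightarrow> (\<exists>t. walk G (x \<otimes>\<^bsub>G\<^esub> g) \<omega> t \<in> H)"
    using assms by (metis walk.simps(1) walk_Stream not0_implies_Suc)
  have "(LEAST t. walk G x (g ## \<omega>) t \<in> H) = Suc (LEAST t. walk G (x \<otimes>\<^bsub>G\<^esub> g) \<omega> t \<in> H)"
    if "walk G (x \<otimes>\<^bsub>G\<^esub> g) \<omega> t \<in> H" for t
    using Least_Suc[of "\<lambda>t. walk G x (g ## \<omega>) t \<in> H" "Suc t"] assms that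
    by (simp add: walk_Stream del: walk.simps(2))
  then show ?thesis unfolding stopped_value_eq ex by (auto simp: walk_Stream simp del: walk.simps(2))
qed

section \<open>Step law, path measure and measurability of the walk\<close>

locale finite_index_walk = group G for G (structure) +
  fixes H S :: "'a set" and \<mu> :: "'a pmf"
  assumes gen: "fin_sym_gen G S"
    and subH: "subgroup H G"
    and fin_index: "finite (rcosets H)"
    and supp: "set_pmf \<mu> \<subseteq> carrier G"
    and adapted: "adapted G \<mu>"
    and smooth: "smooth G S \<mu>"
begin

sublocale H: subgroup H G by (rule subH)

abbreviation "M \<equiv> restrict_space (measure_pmf \<mu>) (carrier G)"
abbreviation "W \<equiv> walk_space G \<mu>"

lemma sets_M: "sets M = Pow (carrier G)"
  by (auto simp: sets_restrict_space)

lemma sets_M_count [measurable_cong]: "sets M = sets (count_space (carrier G))"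
  by (simp add: sets_M)

lemma space_M [simp]: "space M = carrier G"
  by (simp add: space_restrict_space)

sublocale M: prob_space M
proof (rule prob_space_restrict_space)
  show "emeasure (measure_pmf \<mu>) (carrier G) = 1"
    using supp by (simp add: measure_pmf.emeasure_eq_1_AE AE_measure_pmf_iff subset_iff)
qed simp

lemma W_eq: "W = stream_space M"
  by (simp add: walk_space_def)

sublocale W: prob_space W
  unfolding W_eq by (rule M.prob_space_stream_space)

lemma sets_W [measurable_cong]: "sets W = sets (stream_space M)"
  by (simp add: W_eq)

lemma AE_step: "(\<And>g. g \<in> carrier G \<Longrightarrow> P g) \<Longrightarrow> AE g in measure_pmf \<mu>. P g"
  using supp by (auto simp: AE_measure_pmf_iff)

text \<open>Path measures are built from \<open>M\<close>, where the group product is measurable;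
  one-step integrals are moved to \<open>measure_pmf \<mu>\<close>, where every function is
  measurable.\<close>

lemma nn_integral_M: "(\<integral>\<^sup>+g. f g \<partial>M) = (\<integral>\<^sup>+g. f g \<partial>measure_pmf \<mu>)"
  by (subst nn_integral_restrict_space) (auto intro!: nn_integral_cong_AE AE_step)

lemma integral_M:
  fixes f :: "'a \<Rightarrow> complex"
  shows "(LINT g|M. f g) = (LINT g|measure_pmf \<mu>. f g)"
  by (subst integral_restrict_space) (auto intro!: integral_cong_AE AE_step)

lemma integrable_M:
  fixes f :: "'a \<Rightarrow> complex"
  shows "integrable M f \<longleftrightarrow> integrable (measure_pmf \<mu>) f"
proof -
  have "integrable M f \<longleftrightarrow> integrable (measure_pmf \<mu>) (\<lambda>g. indicator (carrier G) g *\<^sub>R f g)"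
    by (rule integrable_restrict_space) simp
  also have "\<dots> \<longleftrightarrow> integrable (measure_pmf \<mu>) f"
    by (rule integrable_cong_AE) (auto intro!: AE_step)
  finally show ?thesis .
qed

lemma nn_integral_step_mono:
  assumes "\<And>g. g \<in> carrier G \<Longrightarrow> f g \<le> h g"
  shows "(\<integral>\<^sup>+g. f g \<partial>measure_pmf \<mu>) \<le> (\<integral>\<^sup>+g. h g \<partial>measure_pmf \<mu>)"
  using assms by (intro nn_integral_mono_AE AE_step)

lemma nn_integral_step_cong:
  assumes "\<And>g. g \<in> carrier G \<Longrightarrow> f g = h g"
  shows "(\<integral>\<^sup>+g. f g \<partial>measure_pmf \<mu>) = (\<integral>\<^sup>+g. h g \<partial>measure_pmf \<mu>)"
  using assms by (intro nn_integral_cong_AE AE_step)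

lemma nn_integral_W:
  assumes "f \<in> borel_measurable W"
  shows "(\<integral>\<^sup>+\<omega>. f \<omega> \<partial>W) = (\<integral>\<^sup>+g. \<integral>\<^sup>+\<omega>. f (g ## \<omega>) \<partial>W \<partial>measure_pmf \<mu>)"
  using M.nn_integral_stream_space[of f] assms by (simp add: W_eq nn_integral_M)

lemma snth_measurable [measurable]: "(\<lambda>\<omega>. \<omega> !! t) \<in> W \<rightarrow>\<^sub>M count_space (carrier G)"
  using measurable_snth[of t M] by (simp add: W_eq cong: measurable_cong_sets)

text \<open>For a fixed previous position the next one is a function of a single increment;
  countability of the group lets that position be random.\<close>

lemma walk_measurable:
  assumes "x \<in> carrier G"
  shows "(\<lambda>\<omega>. walk G x \<omega> t) \<in> W \<rightarrow>\<^sub>M count_space (carrier G)"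
proof (induction t)
  case 0 then show ?case using assms by simp
next
  case (Suc t)
  have "(\<lambda>\<omega>. y \<otimes> \<omega> !! t) \<in> W \<rightarrow>\<^sub>M count_space (carrier G)" if "y \<in> carrier G" for y
    by (rule measurable_compose[OF snth_measurable]) (use that in auto)
  from measurable_compose_countable'[OF this Suc countable_carrier[OF gen]] show ?case by simp
qed

lemma walk_in_H_measurable [measurable]:
  assumes "x \<in> carrier G"
  shows "Measurable.pred W (\<lambda>\<omega>. walk G x \<omega> t \<in> H)"
  by (rule measurable_compose[OF walk_measurable[OF assms]]) auto

lemma stopped_value_measurable [measurable]:
  fixes f :: "'a \<Rightarrow> complex"
  assumes x: "x \<in> carrier G"
  shows "stopped_value G H f x \<in> borel_measurable W"
proof -
  have [measurable]: "(\<lambda>\<omega>. f (walk G x \<omega> t)) \<in> borel_measurable W" for t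
    by (rule measurable_compose[OF walk_measurable[OF x]]) auto
  have [measurable]: "(\<lambda>\<omega>. LEAST t. walk G x \<omega> t \<in> H) \<in> W \<rightarrow>\<^sub>M count_space UNIV"
    using x by measurable
  have [measurable]: "(\<lambda>\<omega>. f (walk G x \<omega> (LEAST t. walk G x \<omega> t \<in> H))) \<in> borel_measurable W"
    by (rule measurable_compose_countable[where f="\<lambda>t \<omega>. f (walk G x \<omega> t)"]) measurable
  show ?thesis unfolding stopped_value_eq[abs_def] using x by measurable
qed

section \<open>Tail of the hitting time\<close>

text \<open>\<open>avoid_prob n x\<close> is the probability that the walk from \<open>x\<close> avoids \<open>H\<close> up to and including time \<open>n\<close>.\<close>

primrec avoid_prob :: "nat \<Rightarrow> 'a \<Rightarrow> ennreal" where
  "avoid_prob 0 x = (if x \<in> H then 0 else 1)"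
| "avoid_prob (Suc n) x = (if x \<in> H then 0 else \<integral>\<^sup>+g. avoid_prob n (x \<otimes> g) \<partial>measure_pmf \<mu>)"

lemma avoid_prob_in: "x \<in> H \<Longrightarrow> avoid_prob n x = 0"
  by (cases n) auto

lemma avoid_prob_le_1: "avoid_prob n x \<le> 1"
proof (induction n arbitrary: x)
  case (Suc n)
  have "(\<integral>\<^sup>+g. avoid_prob n (x \<otimes> g) \<partial>measure_pmf \<mu>) \<le> (\<integral>\<^sup>+g. 1 \<partial>measure_pmf \<mu>)"
    by (intro nn_integral_mono Suc)
  then show ?case by simp
qed simp

lemma avoid_prob_Suc_le: "avoid_prob (Suc n) x \<le> avoid_prob n x"
proof (induction n arbitrary: x)
  case 0 then show ?case using avoid_prob_le_1[of 1 x] by (auto simp: avoid_prob_in)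
next
  case (Suc n)
  then have "(\<integral>\<^sup>+g. avoid_prob (Suc n) (x \<otimes> g) \<partial>measure_pmf \<mu>) \<le> (\<integral>\<^sup>+g. avoid_prob n (x \<otimes> g) \<partial>measure_pmf \<mu>)"
    by (intro nn_integral_mono)
  then show ?case by simp
qed

lemma avoid_prob_antimono: "m \<le> n \<Longrightarrow> avoid_prob n x \<le> avoid_prob m x"
  using lift_Suc_antimono_le[of "\<lambda>n. avoid_prob n x"] avoid_prob_Suc_le by blast

lemma mult_left_H_iff:
  assumes "h \<in> H" "x \<in> carrier G"
  shows "h \<otimes> x \<in> H \<longleftrightarrow> x \<in> H"
proof
  assume "h \<otimes> x \<in> H"
  then have "inv h \<otimes> (h \<otimes> x) \<in> H" using assms by simp
  then show "x \<in> H" using assms by (simp add: m_assoc[symmetric])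
qed (use assms in simp)

text \<open>Left multiplication by \<open>h\<close> commutes with the right steps and maps
  \<open>H\<close> and its complement to themselves. Thus \<open>avoid_prob n\<close> is a function
  on the finite set of right cosets.\<close>

lemma avoid_prob_left_invariant: "h \<in> H \<Longrightarrow> x \<in> carrier G \<Longrightarrow> avoid_prob n (h \<otimes> x) = avoid_prob n x"
proof (induction n arbitrary: x)
  case (Suc n)
  have "(\<integral>\<^sup>+g. avoid_prob n (h \<otimes> x \<otimes> g) \<partial>measure_pmf \<mu>) = (\<integral>\<^sup>+g. avoid_prob n (x \<otimes> g) \<partial>measure_pmf \<mu>)"
    using Suc by (intro nn_integral_step_cong) (simp add: m_assoc H.mem_carrier)
  then show ?case using Suc.prems by (simp add: mult_left_H_iff)
qed (simp add: mult_left_H_iff)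

text \<open>The integrand never exceeds 1 and is strictly smaller at \<open>a\<close>, an atom of
  positive mass.\<close>

lemma avoid_prob_less_1_step:
  assumes "a \<in> set_pmf \<mu>" "avoid_prob m (x \<otimes> a) < 1"
  shows "avoid_prob (Suc m) x < 1"
proof -
  have "(\<integral>\<^sup>+g. avoid_prob m (x \<otimes> g) \<partial>measure_pmf \<mu>) < (\<integral>\<^sup>+g. 1 \<partial>measure_pmf \<mu>)"
  proof (rule nn_integral_less)
    have "(\<integral>\<^sup>+g. avoid_prob m (x \<otimes> g) \<partial>measure_pmf \<mu>) \<le> (\<integral>\<^sup>+g. 1 \<partial>measure_pmf \<mu>)"
      by (intro nn_integral_mono avoid_prob_le_1)
    then show "(\<integral>\<^sup>+g. avoid_prob m (x \<otimes> g) \<partial>measure_pmf \<mu>) \<noteq> \<infinity>"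
      by (auto simp: top_unique)
    show "\<not> (AE g in measure_pmf \<mu>. 1 \<le> avoid_prob m (x \<otimes> g))"
      using assms by (auto simp: AE_measure_pmf_iff not_le)
  qed (auto simp: avoid_prob_le_1)
  then show ?thesis by simp
qed

text \<open>Adaptedness makes \<open>inv x\<close> a product of support elements, and following that
  product leads from \<open>x\<close> to the identity, a point of \<open>H\<close>.\<close>

lemma avoid_prob_less_1:
  assumes x: "x \<in> carrier G"
  shows "\<exists>n. avoid_prob n x < 1"
proof -
  have sg: "semigroup_generate G (set_pmf \<mu>) = carrier G"
    using adapted by (simp add: adapted_def)
  \<comment> \<open>A positive chance to hit is pulled back along \<open>a\<close>. Quantifying over
    all \<open>x\<close> and \<open>m\<close> makes this property of \<open>a\<close> closed under
    products: pull back along \<open>b\<close> from \<open>x \<otimes> a \<otimes> b\<close>, then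
    along \<open>a\<close>.\<close>
  have "\<forall>x\<in>carrier G. \<forall>m. avoid_prob m (x \<otimes> a) < 1 \<longrightarrow> (\<exists>n. avoid_prob n x < 1)"
    if "a \<in> semigroup_generate G (set_pmf \<mu>)" for a
    using that
  proof induction
    case (incl a) then show ?case using avoid_prob_less_1_step by blast
  next
    case (mult a b)
    show ?case
    proof (intro ballI allI impI)
      fix x m assume x: "x \<in> carrier G" and m: "avoid_prob m (x \<otimes> (a \<otimes> b)) < 1"
      have ab: "a \<in> carrier G" "b \<in> carrier G" using mult.hyps sg by auto
      then have "avoid_prob m ((x \<otimes> a) \<otimes> b) < 1" using m x by (simp add: m_assoc)
      then obtain n where "avoid_prob n (x \<otimes> a) < 1" using mult.IH(2) x ab by blast
      then show "\<exists>n. avoid_prob n x < 1" using mult.IH(1) x by blast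
    qed
  qed
  moreover have "inv x \<in> semigroup_generate G (set_pmf \<mu>)" using sg x by simp
  moreover have "avoid_prob 0 (x \<otimes> inv x) < 1" using x by simp
  ultimately show ?thesis using x by blast
qed

text \<open>Every \<open>x\<close> lies in the coset of one of finitely many representatives, and
  \<open>avoid_prob\<close> decreases in time; a common late time and a maximum over representatives
  therefore suffice.\<close>

lemma avoid_prob_uniform: "\<exists>N c. c < 1 \<and> (\<forall>x\<in>carrier G. avoid_prob N x \<le> c)"
proof -
  obtain r where R: "\<forall>x\<in>carrier G. r x \<in> carrier G" "\<forall>x\<in>carrier G. x \<otimes> inv (r x) \<in> H"
    "finite (r ` carrier G)"
    using finite_transversal[OF subH fin_index] by (elim exE conjE)
  define T where "T = r ` carrier G"
  have T: "finite T" "T \<noteq> {}" "T \<subseteq> carrier G" using R by (auto simp: T_def)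
  obtain n where n: "\<And>t. t \<in> T \<Longrightarrow> avoid_prob (n t) t < 1"
    using avoid_prob_less_1 T(3) by (metis subsetD)
  \<comment> \<open>Any bound for all \<open>n t\<close> would do; the sum is one.\<close>
  define N where "N = sum n T"
  have N: "avoid_prob N t < 1" if "t \<in> T" for t
    using avoid_prob_antimono[of "n t" N t] member_le_sum[OF that, of n] T(1) n[OF that]
    by (auto simp: N_def)
  have "avoid_prob N x \<le> Max (avoid_prob N ` T)" if x: "x \<in> carrier G" for x
  proof -
    have "avoid_prob N ((x \<otimes> inv (r x)) \<otimes> r x) = avoid_prob N (r x)"
      using R x by (intro avoid_prob_left_invariant) auto
    then have "avoid_prob N x = avoid_prob N (r x)" using R x by (simp add: m_assoc)
    then show ?thesis using T x by (auto simp: T_def)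
  qed
  moreover have "Max (avoid_prob N ` T) < 1" using T N by (subst Max_less_iff) auto
  ultimately show ?thesis by blast
qed

text \<open>Uniformity in \<open>n\<close> comes from the self-bound \<open>U \<le> N + c U\<close> of the finite sum \<open>U\<close>, with \<open>c < 1\<close>.\<close>

lemma avoid_prob_sum_bounded: "\<exists>K\<ge>0. \<forall>n. \<forall>x\<in>carrier G. (\<Sum>t<n. avoid_prob t x) \<le> ennreal K"
proof -
  obtain N c where c: "c < 1" and N: "\<And>x. x \<in> carrier G \<Longrightarrow> avoid_prob N x \<le> c"
    using avoid_prob_uniform by blast
  obtain c' where c': "c = ennreal c'" "0 \<le> c'" "c' < 1"
    using c by (cases c) (auto simp: ennreal_less_one_iff)
  \<comment> \<open>Surviving \<open>N\<close> further steps costs a factor \<open>c\<close>. The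
    induction peels off first steps, so the block of length \<open>N\<close> is the last one; at
    \<open>t = 0\<close> both sides vanish for \<open>x\<close> in \<open>H\<close>.\<close>
  have shift: "avoid_prob (N + t) x \<le> c * avoid_prob t x" if "x \<in> carrier G" for t x
    using that
  proof (induction t arbitrary: x)
    case 0 then show ?case using N by (auto simp: avoid_prob_in)
  next
    case (Suc t)
    have "(\<integral>\<^sup>+g. avoid_prob (N + t) (x \<otimes> g) \<partial>measure_pmf \<mu>) \<le> (\<integral>\<^sup>+g. c * avoid_prob t (x \<otimes> g) \<partial>measure_pmf \<mu>)"
      using Suc by (intro nn_integral_step_mono) auto
    also have "\<dots> = c * (\<integral>\<^sup>+g. avoid_prob t (x \<otimes> g) \<partial>measure_pmf \<mu>)" by (rule nn_integral_cmult) simp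
    finally show ?case by simp
  qed
  have split: "(\<Sum>t<N + n. avoid_prob t x) = (\<Sum>t<N. avoid_prob t x) + (\<Sum>t<n. avoid_prob (N + t) x)" for n x
    by (induction n) (auto simp: add.assoc)
  have "(\<Sum>t<n. avoid_prob t x) \<le> ennreal (real N / (1 - c'))" if x: "x \<in> carrier G" for n x
  proof -
    let ?U = "\<Sum>t<n. avoid_prob t x"
    \<comment> \<open>The crude bound by \<open>n\<close> secures finiteness, without which
      \<open>c * U\<close> could not be subtracted from the self-bound.\<close>
    have "?U \<le> (\<Sum>t<n. 1)" by (intro sum_mono avoid_prob_le_1)
    also have "\<dots> < \<infinity>" by (simp add: of_nat_less_top)
    finally have "?U < \<infinity>" .
    then obtain u where u: "?U = ennreal u" "0 \<le> u" by (cases ?U) auto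
    have "?U \<le> (\<Sum>t<N + n. avoid_prob t x)" by (intro sum_mono2) auto
    also have "\<dots> \<le> (\<Sum>t<N. 1) + (\<Sum>t<n. c * avoid_prob t x)"
      unfolding split using x by (intro add_mono sum_mono avoid_prob_le_1 shift)
    also have "\<dots> = ennreal (real N + c' * u)"
      using u c' by (simp add: sum_distrib_left[symmetric] ennreal_mult ennreal_of_nat_eq_real_of_nat)
    finally have "u \<le> real N + c' * u"
      unfolding u(1) using u(2) c' by (subst (asm) ennreal_le_iff) auto
    then have "u \<le> real N / (1 - c')" using c' by (simp add: field_simps)
    then show ?thesis using u by (simp add: ennreal_leI)
  qed
  then show ?thesis using c' by (intro exI[of _ "real N / (1 - c')"]) auto
qed

text \<open>Both sides obey the same first-step recursion, which identifies
  \<open>avoid_prob\<close> with a genuine path probability.\<close>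

lemma emeasure_avoid:
  assumes "x \<in> carrier G"
  shows "emeasure W {\<omega>\<in>space W. \<forall>t\<le>n. walk G x \<omega> t \<notin> H} = avoid_prob n x"
  using assms
proof (induction n arbitrary: x)
  case 0
  then show ?case using W.emeasure_space_1 by auto
next
  case (Suc n)
  let ?A = "\<lambda>n x. {\<omega>\<in>space W. \<forall>t\<le>n. walk G x \<omega> t \<notin> H}"
  have m: "?A n x \<in> sets W" if "x \<in> carrier G" for n x
    using that by measurable
  show ?case
  proof (cases "x \<in> H")
    case True
    then have "walk G x \<omega> 0 \<in> H" for \<omega> by simp
    then have "?A (Suc n) x = {}" by blast
    then show ?thesis using True by (simp only: emeasure_empty avoid_prob_in)
  next
    case False
    have eq: "indicator (?A (Suc n) x) (g ## \<omega>) = (indicator (?A n (x \<otimes> g)) \<omega> :: ennreal)"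
      if "g \<in> carrier G" "\<omega> \<in> space W" for g \<omega>
    proof -
      have "(\<forall>t\<le>Suc n. walk G x (g ## \<omega>) t \<notin> H) \<longleftrightarrow> (\<forall>t\<le>n. walk G (x \<otimes> g) \<omega> t \<notin> H)"
        using False by (metis walk.simps(1) walk_Stream not0_implies_Suc Suc_le_mono)
      then show ?thesis using that by (auto simp: indicator_def W_eq space_stream_space)
    qed
    have "emeasure W (?A (Suc n) x) = (\<integral>\<^sup>+\<omega>. indicator (?A (Suc n) x) \<omega> \<partial>W)"
      by (rule nn_integral_indicator[OF m[OF Suc.prems], symmetric])
    also have "\<dots> = (\<integral>\<^sup>+g. \<integral>\<^sup>+\<omega>. indicator (?A (Suc n) x) (g ## \<omega>) \<partial>W \<partial>measure_pmf \<mu>)"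
      by (rule nn_integral_W[OF borel_measurable_indicator[OF m[OF Suc.prems]]])
    also have "\<dots> = (\<integral>\<^sup>+g. avoid_prob n (x \<otimes> g) \<partial>measure_pmf \<mu>)"
    proof (rule nn_integral_step_cong)
      fix g assume g: "g \<in> carrier G"
      have "(\<integral>\<^sup>+\<omega>. indicator (?A (Suc n) x) (g ## \<omega>) \<partial>W) = (\<integral>\<^sup>+\<omega>. indicator (?A n (x \<otimes> g)) \<omega> \<partial>W)"
        using g by (intro nn_integral_cong eq)
      also have "\<dots> = emeasure W (?A n (x \<otimes> g))"
        using g Suc.prems by (intro nn_integral_indicator m) simp
      also have "\<dots> = avoid_prob n (x \<otimes> g)"
        using g Suc.prems by (intro Suc.IH) simp
      finally show "(\<integral>\<^sup>+\<omega>. indicator (?A (Suc n) x) (g ## \<omega>) \<partial>W) = avoid_prob n (x \<otimes> g)" .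
    qed
    finally show ?thesis using False by simp
  qed
qed

text \<open>The event of no hit has probability at most each \<open>avoid_prob t x\<close>. Summing
  \<open>n\<close> of these bounds, \<open>n\<close> times that probability stays below
  \<open>K\<close> for all \<open>n\<close>, so it is 0.\<close>

lemma AE_hits:
  assumes x: "x \<in> carrier G"
  shows "AE \<omega> in W. \<exists>t. walk G x \<omega> t \<in> H"
proof -
  let ?A = "{\<omega>\<in>space W. \<forall>t. walk G x \<omega> t \<notin> H}"
  obtain K where K: "0 \<le> K" "\<And>n. (\<Sum>t<n. avoid_prob t x) \<le> ennreal K" using avoid_prob_sum_bounded x by auto
  have mA: "?A \<in> sets W" using x by measurable
  have "emeasure W ?A \<le> avoid_prob t x" for t
    unfolding emeasure_avoid[OF x, symmetric] using x by (intro emeasure_mono) auto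
  then have "(\<Sum>t<n. emeasure W ?A) \<le> ennreal K" for n :: nat
    using K(2)[of n] by (meson order_trans sum_mono)
  then have le: "of_nat n * emeasure W ?A \<le> ennreal K" for n by simp
  have "real n * measure W ?A \<le> K" for n
  proof -
    have "ennreal (real n * measure W ?A) \<le> ennreal K"
      using le[of n] by (simp add: W.emeasure_eq_measure ennreal_mult ennreal_of_nat_eq_real_of_nat)
    then show ?thesis using K(1) by (simp add: ennreal_le_iff)
  qed
  then have "\<not> 0 < measure W ?A"
    using reals_Archimedean3[of "measure W ?A"] by (meson not_le)
  then have "emeasure W ?A = 0"
    unfolding W.emeasure_eq_measure by (simp only: zero_less_measure_iff not_not ennreal_0)
  then show ?thesis by (subst AE_iff_measurable[OF mA]) auto
qed

section \<open>Displacement at the hitting time\<close>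

text \<open>The exponential moment dominates: a real number is at most its exponential, so a length
  is at most \<open>1 / \<zeta>\<close> times the exponential of \<open>\<zeta>\<close> times
  it.\<close>

lemma first_moment: "(\<integral>\<^sup>+g. ennreal (real (word_length G S g)) \<partial>measure_pmf \<mu>) < \<infinity>"
proof -
  obtain \<zeta> where z: "\<zeta> > 0" "(\<lambda>x. pmf \<mu> x * exp (\<zeta> * real (word_length G S x))) summable_on carrier G"
    using smooth by (auto simp: smooth_def)
  have "(\<lambda>x. norm (of_real (pmf \<mu> x) * complex_of_real (exp (\<zeta> * real (word_length G S x))))) summable_on carrier G"
    using z(2) by (simp only: of_real_mult[symmetric] norm_of_real abs_of_nonneg pmf_nonneg zero_le_mult_iff exp_ge_zero simp_thms abs_mult)
  then have "integrable (measure_pmf \<mu>) (\<lambda>x. complex_of_real (exp (\<zeta> * real (word_length G S x))))"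
    by (subst integrable_measure_pmf_iff_summable[OF supp])
  then have fin: "(\<integral>\<^sup>+g. ennreal (exp (\<zeta> * real (word_length G S g))) \<partial>measure_pmf \<mu>) < \<infinity>"
    by (simp add: integrable_iff_bounded)
  have "(\<integral>\<^sup>+g. ennreal (real (word_length G S g)) \<partial>measure_pmf \<mu>)
      \<le> (\<integral>\<^sup>+g. ennreal (1 / \<zeta>) * ennreal (exp (\<zeta> * real (word_length G S g))) \<partial>measure_pmf \<mu>)"
  proof (rule nn_integral_mono)
    fix g
    have "\<zeta> * real (word_length G S g) \<le> exp (\<zeta> * real (word_length G S g))"
      using exp_ge_add_one_self[of "\<zeta> * real (word_length G S g)"] by linarith
    then have "real (word_length G S g) \<le> (1 / \<zeta>) * exp (\<zeta> * real (word_length G S g))"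
      using z(1) by (simp add: field_simps)
    then show "ennreal (real (word_length G S g)) \<le> ennreal (1 / \<zeta>) * ennreal (exp (\<zeta> * real (word_length G S g)))"
      using z(1) by (subst ennreal_mult[symmetric]) (auto intro: ennreal_leI)
  qed
  also have "\<dots> = ennreal (1 / \<zeta>) * (\<integral>\<^sup>+g. ennreal (exp (\<zeta> * real (word_length G S g))) \<partial>measure_pmf \<mu>)"
    by (rule nn_integral_cmult) simp
  also have "\<dots> < \<infinity>" using fin by (simp add: ennreal_mult_less_top)
  finally show ?thesis .
qed

text \<open>Wald's estimate: a truncation at time \<open>n\<close> makes it an induction over the first step.\<close>

lemma truncated_displacement:
  assumes "0 \<le> L" and x: "x \<in> carrier G"
    and lip: "\<And>s x. s \<in> S \<Longrightarrow> x \<in> carrier G \<Longrightarrow> cmod (F (x \<otimes> s) - F x) \<le> L"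
  shows "(\<integral>\<^sup>+\<omega>. (if \<exists>t\<le>n. walk G x \<omega> t \<in> H then ennreal (cmod (stopped_value G H F x \<omega> - F x)) else 0) \<partial>W)
    \<le> ennreal L * (\<integral>\<^sup>+g. ennreal (real (word_length G S g)) \<partial>measure_pmf \<mu>) * (\<Sum>t<n. avoid_prob t x)"
  using x
proof (induction n arbitrary: x)
  let ?D = "\<lambda>n x \<omega>. if \<exists>t\<le>n. walk G x \<omega> t \<in> H then ennreal (cmod (stopped_value G H F x \<omega> - F x)) else 0"
  \<comment> \<open>Started in \<open>H\<close> the walk is stopped at once, so there is no
    displacement.\<close>
  have D0: "?D n x \<omega> = 0" if "x \<in> H" for n x \<omega>
    using stopped_value_in[OF that, of G F \<omega>] by simp
  case 0
  have "?D 0 x \<omega> = 0" for \<omega> using D0[of x 0 \<omega>] by (cases "x \<in> H") auto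
  then show ?case by (simp del: walk.simps)
  case (Suc n)
  let ?m = "\<integral>\<^sup>+g. ennreal (real (word_length G S g)) \<partial>measure_pmf \<mu>"
  have mD: "?D n x \<in> borel_measurable W" if "x \<in> carrier G" for n x
    using that by measurable
  show ?case
  proof (cases "x \<in> H")
    case True
    then show ?thesis by (simp add: D0)
  next
    case False
    \<comment> \<open>Off \<open>H\<close> the stopped value is that of the shifted walk from
      \<open>x \<otimes> g\<close>; replacing the reference value \<open>F (x \<otimes> g)\<close>
      by \<open>F x\<close> costs at most \<open>L\<close> times the length of
      \<open>g\<close>.\<close>
    have step: "?D (Suc n) x (g ## \<omega>) \<le> ?D n (x \<otimes> g) \<omega> + ennreal L * ennreal (real (word_length G S g))"
      if g: "g \<in> carrier G" for g \<omega>
    proof -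
      have ex: "(\<exists>t\<le>Suc n. walk G x (g ## \<omega>) t \<in> H) \<longleftrightarrow> (\<exists>t\<le>n. walk G (x \<otimes> g) \<omega> t \<in> H)"
        using False by (metis walk.simps(1) walk_Stream not0_implies_Suc Suc_le_mono)
      have "cmod ((stopped_value G H F (x \<otimes> g) \<omega> - F (x \<otimes> g)) + (F (x \<otimes> g) - F x))
          \<le> cmod (stopped_value G H F (x \<otimes> g) \<omega> - F (x \<otimes> g)) + L * real (word_length G S g)"
        using lipschitz_word_length[OF gen Suc.prems g lip] by (intro norm_triangle_mono) auto
      then have "ennreal (cmod (stopped_value G H F (x \<otimes> g) \<omega> - F x))
          \<le> ennreal (cmod (stopped_value G H F (x \<otimes> g) \<omega> - F (x \<otimes> g))) + ennreal L * ennreal (real (word_length G S g))"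
        using assms(1) by (simp add: ennreal_mult[symmetric] ennreal_plus[symmetric] ennreal_leI del: ennreal_plus)
      then show ?thesis unfolding ex stopped_value_Stream[OF False] by auto
    qed
    have "(\<integral>\<^sup>+\<omega>. ?D (Suc n) x \<omega> \<partial>W) = (\<integral>\<^sup>+g. \<integral>\<^sup>+\<omega>. ?D (Suc n) x (g ## \<omega>) \<partial>W \<partial>measure_pmf \<mu>)"
      by (rule nn_integral_W[OF mD[OF Suc.prems]])
    also have "\<dots> \<le> (\<integral>\<^sup>+g. ennreal L * ?m * (\<Sum>t<n. avoid_prob t (x \<otimes> g)) + ennreal L * ennreal (real (word_length G S g)) \<partial>measure_pmf \<mu>)"
    proof (rule nn_integral_step_mono)
      fix g assume g: "g \<in> carrier G"
      have "(\<integral>\<^sup>+\<omega>. ?D (Suc n) x (g ## \<omega>) \<partial>W)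
          \<le> (\<integral>\<^sup>+\<omega>. ?D n (x \<otimes> g) \<omega> + ennreal L * ennreal (real (word_length G S g)) \<partial>W)"
        by (intro nn_integral_mono step g)
      also have "\<dots> = (\<integral>\<^sup>+\<omega>. ?D n (x \<otimes> g) \<omega> \<partial>W) + ennreal L * ennreal (real (word_length G S g))"
        using mD[of "x \<otimes> g" n] g Suc.prems by (subst nn_integral_add) (auto simp: W.emeasure_space_1)
      also have "\<dots> \<le> ennreal L * ?m * (\<Sum>t<n. avoid_prob t (x \<otimes> g)) + ennreal L * ennreal (real (word_length G S g))"
        using Suc.IH[of "x \<otimes> g"] g Suc.prems by (intro add_right_mono) auto
      finally show "(\<integral>\<^sup>+\<omega>. ?D (Suc n) x (g ## \<omega>) \<partial>W)
        \<le> ennreal L * ?m * (\<Sum>t<n. avoid_prob t (x \<otimes> g)) + ennreal L * ennreal (real (word_length G S g))" .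
    qed
    also have "\<dots> = ennreal L * ?m * (\<Sum>t<n. \<integral>\<^sup>+g. avoid_prob t (x \<otimes> g) \<partial>measure_pmf \<mu>) + ennreal L * ?m"
      by (simp add: nn_integral_add nn_integral_cmult nn_integral_sum)
    \<comment> \<open>Off \<open>H\<close>, \<open>avoid_prob 0 x = 1\<close> pays for the first
      step, and the integral of \<open>avoid_prob t\<close> after that step is
      \<open>avoid_prob (Suc t) x\<close>.\<close>
    also have "\<dots> = ennreal L * ?m * (\<Sum>t<Suc n. avoid_prob t x)"
      using False by (simp add: sum.lessThan_Suc_shift distrib_left add.commute del: sum.lessThan_Suc)
    finally show ?thesis .
  qed
qed

text \<open>Almost every path hits \<open>H\<close>, and on such a path the truncated integrand
  equals the full one from the hitting time on; monotone convergence removes the truncation. The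
  constant is the mean step length times the bound \<open>K\<close> on the summed tail, plus 1 for
  positivity, and it is independent of \<open>F\<close> and \<open>L\<close>.\<close>

lemma displacement_bound:
  "\<exists>C>0. \<forall>F L. 0 \<le> L \<longrightarrow> (\<forall>s\<in>S. \<forall>x\<in>carrier G. cmod (F (x \<otimes> s) - F x) \<le> L) \<longrightarrow>
    (\<forall>x\<in>carrier G. (\<integral>\<^sup>+\<omega>. ennreal (cmod (stopped_value G H F x \<omega> - F x)) \<partial>W) \<le> ennreal (C * L))"
proof -
  obtain m where m: "0 \<le> m" "(\<integral>\<^sup>+g. ennreal (real (word_length G S g)) \<partial>measure_pmf \<mu>) = ennreal m"
    using first_moment by (cases "\<integral>\<^sup>+g. ennreal (real (word_length G S g)) \<partial>measure_pmf \<mu>") auto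
  obtain K where K: "0 \<le> K" "\<And>n x. x \<in> carrier G \<Longrightarrow> (\<Sum>t<n. avoid_prob t x) \<le> ennreal K"
    using avoid_prob_sum_bounded by auto
  have "(\<integral>\<^sup>+\<omega>. ennreal (cmod (stopped_value G H F x \<omega> - F x)) \<partial>W) \<le> ennreal ((m * K + 1) * L)"
    if L: "0 \<le> L" and lip: "\<forall>s\<in>S. \<forall>x\<in>carrier G. cmod (F (x \<otimes> s) - F x) \<le> L" and x: "x \<in> carrier G" for F L x
  proof -
    let ?D = "\<lambda>n \<omega>. if \<exists>t\<le>n. walk G x \<omega> t \<in> H then ennreal (cmod (stopped_value G H F x \<omega> - F x)) else 0"
    have mD: "?D n \<in> borel_measurable W" for n using x by measurable
    have "(\<integral>\<^sup>+\<omega>. ennreal (cmod (stopped_value G H F x \<omega> - F x)) \<partial>W) \<le> (\<integral>\<^sup>+\<omega>. (SUP n. ?D n \<omega>) \<partial>W)"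
    proof (rule nn_integral_mono_AE, use AE_hits[OF x] in eventually_elim)
      case (elim \<omega>)
      then obtain t where "walk G x \<omega> t \<in> H" by blast
      then have "ennreal (cmod (stopped_value G H F x \<omega> - F x)) = ?D t \<omega>" by auto
      also have "\<dots> \<le> (SUP n. ?D n \<omega>)" by (rule SUP_upper[OF UNIV_I])
      finally show ?case .
    qed
    also have "\<dots> = (SUP n. \<integral>\<^sup>+\<omega>. ?D n \<omega> \<partial>W)"
      using mD by (intro nn_integral_monotone_convergence_SUP)
        (auto simp: incseq_def le_fun_def intro: order_trans)
    also have "\<dots> \<le> ennreal ((m * K + 1) * L)"
    proof (rule SUP_least)
      fix n
      have "(\<integral>\<^sup>+\<omega>. ?D n \<omega> \<partial>W) \<le> ennreal L * ennreal m * (\<Sum>t<n. avoid_prob t x)"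
        unfolding m(2)[symmetric] using L x lip by (intro truncated_displacement) auto
      also have "\<dots> \<le> ennreal L * ennreal m * ennreal K"
        using K(2)[OF x] by (intro mult_left_mono) auto
      also have "\<dots> = ennreal (L * m * K)" using L m(1) K(1) by (simp add: ennreal_mult)
      also have "\<dots> \<le> ennreal ((m * K + 1) * L)"
        using L by (intro ennreal_leI) (simp add: algebra_simps)
      finally show "(\<integral>\<^sup>+\<omega>. ?D n \<omega> \<partial>W) \<le> ennreal ((m * K + 1) * L)" .
    qed
    finally show ?thesis .
  qed
  then show ?thesis using m(1) K(1) by (intro exI[of _ "m * K + 1"]) (auto simp: add_nonneg_pos)
qed

end

text \<open>Lets a function given only on \<open>H\<close> be replaced by its Lipschitz extension;
  paths that never hit contribute 0 in both cases.\<close>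

lemma stopped_value_cong:
  assumes "\<And>y. y \<in> H \<Longrightarrow> f y = f' y"
  shows "stopped_value G H f x \<omega> = stopped_value G H f' x \<omega>"
proof -
  have "f (walk G x \<omega> (LEAST t. walk G x \<omega> t \<in> H)) = f' (walk G x \<omega> (LEAST t. walk G x \<omega> t \<in> H))"
    if "\<exists>t. walk G x \<omega> t \<in> H"
    using LeastI_ex[OF that] by (rule assms)
  then show ?thesis by (simp add: stopped_value_eq)
qed

context finite_index_walk
begin

section \<open>Expectations at the hitting time\<close>

abbreviation lip :: "real \<Rightarrow> ('a \<Rightarrow> complex) \<Rightarrow> bool" where
  "lip L F \<equiv> 0 \<le> L \<and> (\<forall>s\<in>S. \<forall>x\<in>carrier G. cmod (F (x \<otimes> s) - F x) \<le> L)"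

abbreviation hit_exp :: "('a \<Rightarrow> complex) \<Rightarrow> 'a \<Rightarrow> complex" where
  "hit_exp F x \<equiv> LINT \<omega>|W. stopped_value G H F x \<omega>"

lemma space_W: "space W = streams (carrier G)"
  by (simp add: W_eq space_stream_space)

lemma walk_closed:
  "x \<in> carrier G \<Longrightarrow> \<omega> \<in> space W \<Longrightarrow> walk G x \<omega> t \<in> carrier G"
  by (induction t) (auto simp: space_W intro: snth_in)

lemma walk_left_mult:
  assumes "k \<in> carrier G" "x \<in> carrier G" "\<omega> \<in> space W"
  shows "walk G (k \<otimes> x) \<omega> t = k \<otimes> walk G x \<omega> t"
proof (induction t)
  case (Suc t)
  have "\<omega> !! t \<in> carrier G" using assms(3) by (simp add: space_W snth_in)
  then show ?case using Suc assms walk_closed[OF assms(2,3), of t] by (simp add: m_assoc)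
qed simp

lemma stopped_value_left_mult:
  assumes "k \<in> H" "x \<in> carrier G" "\<omega> \<in> space W"
  shows "stopped_value G H (\<lambda>y. F (k \<otimes> y)) x \<omega> = stopped_value G H F (k \<otimes> x) \<omega>"
  using assms walk_closed[OF assms(2,3)] walk_left_mult[OF H.mem_carrier[OF assms(1)] assms(2,3)]
  by (simp add: stopped_value_eq mult_left_H_iff)

text \<open>The walk from \<open>k \<otimes> x\<close> is the left translate by \<open>k\<close> of
  the walk from \<open>x\<close> along the same increments, and translation by an element of
  \<open>H\<close> does not change when \<open>H\<close> is hit.\<close>

lemma hit_exp_left_mult:
  assumes "k \<in> H" "x \<in> carrier G"
  shows "hit_exp (\<lambda>y. F (k \<otimes> y)) x = hit_exp F (k \<otimes> x)"
  using stopped_value_left_mult[OF assms] by (intro Bochner_Integration.integral_cong) auto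

lemma hit_exp_in: "x \<in> H \<Longrightarrow> hit_exp F x = F x"
  using W.prob_space by (simp add: stopped_value_in)

lemma lip_bound:
  assumes "lip L F" "x \<in> carrier G" "g \<in> carrier G"
  shows "cmod (F (x \<otimes> g) - F x) \<le> L * real (word_length G S g)"
  using assms by (intro lipschitz_word_length[OF gen]) auto

lemma hit_exp_bound:
  "\<exists>C>0. \<forall>F L. lip L F \<longrightarrow> (\<forall>x\<in>carrier G. integrable W (stopped_value G H F x) \<and>
     cmod (hit_exp F x - F x) \<le> C * L)"
proof -
  obtain C where C: "0 < C" "\<And>F L x. lip L F \<Longrightarrow> x \<in> carrier G \<Longrightarrow>
      (\<integral>\<^sup>+\<omega>. ennreal (cmod (stopped_value G H F x \<omega> - F x)) \<partial>W) \<le> ennreal (C * L)"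
    using displacement_bound by (elim exE conjE) simp
  have "integrable W (stopped_value G H F x) \<and> cmod (hit_exp F x - F x) \<le> C * L"
    if l: "lip L F" and x: "x \<in> carrier G" for F L x
  proof
    have i: "integrable W (\<lambda>\<omega>. stopped_value G H F x \<omega> - F x)"
      using C(2)[OF l x] x by (intro integrableI_bounded) (auto intro: le_less_trans)
    then have "integrable W (\<lambda>\<omega>. (stopped_value G H F x \<omega> - F x) + F x)"
      by (rule Bochner_Integration.integrable_add) simp
    then show j: "integrable W (stopped_value G H F x)" by simp
    have "hit_exp F x - F x = (LINT \<omega>|W. stopped_value G H F x \<omega> - F x)"
      using j W.prob_space by (simp add: Bochner_Integration.integral_diff)
    also have "ennreal (cmod \<dots>) \<le> (\<integral>\<^sup>+\<omega>. ennreal (cmod (stopped_value G H F x \<omega> - F x)) \<partial>W)"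
      using i by (rule integral_norm_bound_ennreal)
    also note C(2)[OF l x]
    finally show "cmod (hit_exp F x - F x) \<le> C * L" using C(1) l by (simp add: ennreal_le_iff)
  qed
  then show ?thesis using C(1) by blast
qed

lemma integrable_stopped_value:
  "lip L F \<Longrightarrow> x \<in> carrier G \<Longrightarrow> integrable W (stopped_value G H F x)"
  using hit_exp_bound by blast

text \<open>Only off \<open>H\<close> does the first increment merely shift the hitting time. On
  \<open>H\<close> the walk stops at time 0, and whether the averaging property holds there is the
  content of \<open>harmonic_hitting_law_iff\<close>.\<close>

lemma hit_exp_step:
  assumes "integrable W (stopped_value G H F x)" "x \<notin> H"
  shows "integrable (measure_pmf \<mu>) (\<lambda>g. hit_exp F (x \<otimes> g))"
    and "hit_exp F x = (LINT g|measure_pmf \<mu>. hit_exp F (x \<otimes> g))"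
  using M.integral_stream_space[of "stopped_value G H F x"] assms
  by (simp_all add: W_eq[symmetric] stopped_value_Stream integrable_M integral_M)

lemma lip_integrable_step:
  assumes "lip L F" "x \<in> carrier G"
  shows "integrable (measure_pmf \<mu>) (\<lambda>g. F (x \<otimes> g))"
proof -
  have "(\<integral>\<^sup>+g. ennreal (cmod (F (x \<otimes> g) - F x)) \<partial>measure_pmf \<mu>)
      \<le> (\<integral>\<^sup>+g. ennreal L * ennreal (real (word_length G S g)) \<partial>measure_pmf \<mu>)"
    using lip_bound[OF assms] assms(1)
    by (intro nn_integral_step_mono) (simp add: ennreal_mult[symmetric] ennreal_leI)
  also have "\<dots> = ennreal L * (\<integral>\<^sup>+g. ennreal (real (word_length G S g)) \<partial>measure_pmf \<mu>)"
    by (rule nn_integral_cmult) simp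
  also have "\<dots> < \<infinity>" using first_moment by (simp add: ennreal_mult_less_top)
  finally have "integrable (measure_pmf \<mu>) (\<lambda>g. F (x \<otimes> g) - F x)"
    by (intro integrableI_bounded) auto
  then have "integrable (measure_pmf \<mu>) (\<lambda>g. (F (x \<otimes> g) - F x) + F x)"
    by (rule Bochner_Integration.integrable_add) simp
  then show ?thesis by simp
qed

text \<open>A maximum principle: iterating the averaging property until \<open>H\<close> is met
  gives the bound \<open>B * avoid_prob n x\<close> for every \<open>n\<close>.\<close>

lemma bounded_harmonic_off_H_eq_0:
  fixes D :: "'a \<Rightarrow> complex"
  assumes B: "\<And>x. x \<in> carrier G \<Longrightarrow> cmod (D x) \<le> B"
    and H: "\<And>x. x \<in> H \<Longrightarrow> D x = 0"
    and int: "\<And>x. x \<in> carrier G \<Longrightarrow> x \<notin> H \<Longrightarrow> integrable (measure_pmf \<mu>) (\<lambda>g. D (x \<otimes> g))"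
    and step: "\<And>x. x \<in> carrier G \<Longrightarrow> x \<notin> H \<Longrightarrow> D x = (LINT g|measure_pmf \<mu>. D (x \<otimes> g))"
    and x: "x \<in> carrier G"
  shows "D x = 0"
proof -
  have B0: "0 \<le> B" using B[OF one_closed] norm_ge_zero order_trans by blast
  have le: "ennreal (cmod (D x)) \<le> ennreal B * avoid_prob n x" if "x \<in> carrier G" for n x
    using that
  proof (induction n arbitrary: x)
    case 0 then show ?case using B H by (auto intro: ennreal_leI)
  next
    case (Suc n)
    show ?case
    proof (cases "x \<in> H")
      case True then show ?thesis using H by simp
    next
      case False
      have "ennreal (cmod (D x)) \<le> (\<integral>\<^sup>+g. ennreal (cmod (D (x \<otimes> g))) \<partial>measure_pmf \<mu>)"
        using integral_norm_bound_ennreal[OF int[OF Suc.prems False]] step[OF Suc.prems False] by simp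
      also have "\<dots> \<le> (\<integral>\<^sup>+g. ennreal B * avoid_prob n (x \<otimes> g) \<partial>measure_pmf \<mu>)"
        using Suc by (intro nn_integral_step_mono) auto
      also have "\<dots> = ennreal B * avoid_prob (Suc n) x" using False by (simp add: nn_integral_cmult)
      finally show ?thesis .
    qed
  qed
  obtain K where K: "0 \<le> K" "\<And>n. (\<Sum>t<n. avoid_prob t x) \<le> ennreal K" using avoid_prob_sum_bounded x by auto
  \<comment> \<open>Summing the bounds over \<open>t < n\<close> exploits the summable tail
    directly, with no limit of \<open>avoid_prob\<close> to compute.\<close>
  have "real n * cmod (D x) \<le> B * K" for n
  proof -
    have "ennreal (real n * cmod (D x)) = (\<Sum>t<n. ennreal (cmod (D x)))"
      by (simp add: ennreal_mult ennreal_of_nat_eq_real_of_nat)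
    also have "\<dots> \<le> (\<Sum>t<n. ennreal B * avoid_prob t x)" by (intro sum_mono le x)
    also have "\<dots> = ennreal B * (\<Sum>t<n. avoid_prob t x)" by (simp only: sum_distrib_left)
    also have "\<dots> \<le> ennreal B * ennreal K" by (intro mult_left_mono K) simp
    also have "\<dots> = ennreal (B * K)" using B0 K(1) by (simp add: ennreal_mult)
    finally show ?thesis using B0 K(1) by (simp add: ennreal_le_iff)
  qed
  then have "\<not> 0 < cmod (D x)" using reals_Archimedean3[of "cmod (D x)"] by (meson not_le)
  then show ?thesis by simp
qed

section \<open>The hitting law\<close>

text \<open>The position at the positive-time hit. The default \<open>\<one>\<close> on paths
  without return lies in \<open>H\<close>, so all values are in \<open>H\<close> and the law has
  total mass 1.\<close>

definition return_pos :: "'a stream \<Rightarrow> 'a" where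
  "return_pos \<omega> = (if \<exists>t\<ge>1. walk G \<one> \<omega> t \<in> H
     then walk G \<one> \<omega> (LEAST t. 1 \<le> t \<and> walk G \<one> \<omega> t \<in> H) else \<one>)"

lemma return_pos_in: "return_pos \<omega> \<in> H"
proof (cases "\<exists>t\<ge>1. walk G \<one> \<omega> t \<in> H")
  case True
  then have "\<exists>t. 1 \<le> t \<and> walk G \<one> \<omega> t \<in> H" by blast
  from LeastI_ex[OF this] True show ?thesis by (simp only: return_pos_def if_True simp_thms)
next
  case False
  then show ?thesis unfolding return_pos_def by (simp only: if_False) simp
qed

lemma return_pos_measurable: "return_pos \<in> W \<rightarrow>\<^sub>M count_space (carrier G)"
proof -
  note walk_measurable[OF one_closed, measurable]
  have [measurable]: "Measurable.pred W (\<lambda>\<omega>. walk G \<one> \<omega> t \<in> H)" for t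
    by (rule walk_in_H_measurable) simp
  have L: "(\<lambda>\<omega>. LEAST t. 1 \<le> t \<and> walk G \<one> \<omega> t \<in> H) \<in> W \<rightarrow>\<^sub>M count_space UNIV"
    by measurable
  have [measurable]: "(\<lambda>\<omega>. walk G \<one> \<omega> (LEAST t. 1 \<le> t \<and> walk G \<one> \<omega> t \<in> H)) \<in> W \<rightarrow>\<^sub>M count_space (carrier G)"
    by (rule measurable_compose_countable[where f="\<lambda>t \<omega>. walk G \<one> \<omega> t", OF _ L]) measurable
  have [measurable]: "(\<lambda>\<omega>. \<one>) \<in> W \<rightarrow>\<^sub>M count_space (carrier G)" by simp
  show ?thesis unfolding return_pos_def[abs_def] by measurable
qed

lemma return_pos_measurable_UNIV [measurable]: "return_pos \<in> W \<rightarrow>\<^sub>M count_space UNIV"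
  by (rule measurable_compose[OF return_pos_measurable]) simp

text \<open>After the compulsory first step to \<open>g\<close>, the return from the identity is the
  ordinary hit from \<open>g\<close>, where time 0 is allowed.\<close>

lemma return_pos_Stream:
  assumes "g \<in> carrier G" "\<exists>t. walk G g \<omega> t \<in> H"
  shows "F (return_pos (g ## \<omega>)) = stopped_value G H F g \<omega>"
    and "\<exists>t\<ge>1. walk G \<one> (g ## \<omega>) t \<in> H"
proof -
  obtain t where t: "walk G g \<omega> t \<in> H" using assms by blast
  let ?P = "\<lambda>t. 1 \<le> t \<and> walk G \<one> (g ## \<omega>) t \<in> H"
  have P: "?P (Suc s) \<longleftrightarrow> walk G g \<omega> s \<in> H" for s
    using assms(1) by (simp add: walk_Stream del: walk.simps(2))
  then show ex: "\<exists>t\<ge>1. walk G \<one> (g ## \<omega>) t \<in> H" using t by blast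
  have "(LEAST t. ?P t) = Suc (LEAST s. ?P (Suc s))"
    by (rule Least_Suc[of ?P "Suc t"]) (use P t in auto)
  also have "\<dots> = Suc (LEAST s. walk G g \<omega> s \<in> H)" unfolding P ..
  finally have "return_pos (g ## \<omega>) = walk G \<one> (g ## \<omega>) (Suc (LEAST s. walk G g \<omega> s \<in> H))"
    using ex by (simp only: return_pos_def if_True)
  also have "\<dots> = walk G g \<omega> (LEAST s. walk G g \<omega> s \<in> H)"
    using assms(1) by (simp add: walk_Stream del: walk.simps(2))
  finally show "F (return_pos (g ## \<omega>)) = stopped_value G H F g \<omega>"
    using assms(2) by (simp add: stopped_value_eq)
qed

lemma AE_returns: "AE \<omega> in W. \<exists>t\<ge>1. walk G \<one> \<omega> t \<in> H"
proof -
  have [measurable]: "Measurable.pred (stream_space M) (\<lambda>\<omega>. walk G \<one> \<omega> t \<in> H)" for t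
    using walk_in_H_measurable[OF one_closed] by (simp add: W_eq)
  have "AE \<omega> in stream_space M. \<exists>t\<ge>1. walk G \<one> \<omega> t \<in> H"
  proof (subst M.AE_stream_space)
    show "AE g in M. AE \<omega> in stream_space M. \<exists>t\<ge>1. walk G \<one> (g ## \<omega>) t \<in> H"
    proof (rule AE_I2)
      fix g assume "g \<in> space M"
      then have g: "g \<in> carrier G" by simp
      show "AE \<omega> in stream_space M. \<exists>t\<ge>1. walk G \<one> (g ## \<omega>) t \<in> H"
        unfolding W_eq[symmetric] using AE_hits[OF g]
        by eventually_elim (rule return_pos_Stream(2)[OF g])
    qed
  qed measurable
  then show ?thesis unfolding W_eq .
qed

text \<open>The hitting law as a \<open>pmf\<close>, so that \<open>harmonic_pmf_iff\<close> applies
  to it.\<close>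

definition hit_pmf :: "'a pmf" where
  "hit_pmf = Abs_pmf (distr W (count_space UNIV) return_pos)"

lemma measure_hit_pmf: "measure_pmf hit_pmf = distr W (count_space UNIV) return_pos"
  unfolding hit_pmf_def
proof (rule Abs_pmf_inverse, intro CollectI conjI)
  interpret D: prob_space "distr W (count_space UNIV) return_pos"
    by (rule W.prob_space_distr) measurable
  show "prob_space (distr W (count_space UNIV) return_pos)"
    by (rule D.prob_space_axioms)
  have "AE x in distr W (count_space UNIV) return_pos. x \<in> carrier G"
    using return_pos_in H.mem_carrier by (subst AE_distr_iff) auto
  \<comment> \<open>A law concentrated on the countable carrier almost surely charges the point it
    selects.\<close>
  then show "AE x in distr W (count_space UNIV) return_pos. measure (distr W (count_space UNIV) return_pos) {x} \<noteq> 0"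
    using countable_carrier[OF gen] D.AE_support_countable by auto
qed simp

lemma set_hit_pmf: "set_pmf hit_pmf \<subseteq> H"
proof -
  have "AE x in distr W (count_space UNIV) return_pos. x \<in> H"
    using return_pos_in by (subst AE_distr_iff) auto
  then show ?thesis unfolding measure_hit_pmf[symmetric] by (auto simp: AE_measure_pmf_iff)
qed

text \<open>The two events differ only on the null set of paths without return, where
  \<open>return_pos\<close> takes its default.\<close>

lemma hitting_law_eq: "hitting_law G H \<mu> = pmf hit_pmf"
proof
  fix y
  have m: "Measurable.pred W (\<lambda>\<omega>. \<exists>t\<ge>1. walk G \<one> \<omega> t \<in> H)"
    using walk_in_H_measurable[OF one_closed] by measurable
  have r: "hitting_time 1 H (walk G \<one> \<omega>) < \<infinity> \<and> walk G \<one> \<omega> (the_enat (hitting_time 1 H (walk G \<one> \<omega>))) = y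
      \<longleftrightarrow> (\<exists>t\<ge>1. walk G \<one> \<omega> t \<in> H) \<and> return_pos \<omega> = y" for \<omega>
  proof (cases "\<exists>t\<ge>1. walk G \<one> \<omega> t \<in> H")
    case True
    then obtain t where "1 \<le> t" "walk G \<one> \<omega> t \<in> H" by blast
    from hitting_time_eq_Least[of 1 t "walk G \<one> \<omega>" H, OF this] True show ?thesis
      by (simp only: return_pos_def if_True hitting_time_finite_iff simp_thms the_enat.simps enat_ord_code)
  next
    case False
    then show ?thesis by (simp only: hitting_time_finite_iff simp_thms)
  qed
  have "hitting_law G H \<mu> y = measure W {\<omega>\<in>space W. (\<exists>t\<ge>1. walk G \<one> \<omega> t \<in> H) \<and> return_pos \<omega> = y}"
    unfolding hitting_law_def r ..
  also have "\<dots> = measure W (return_pos -` {y} \<inter> space W)"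
  proof (rule W.finite_measure_eq_AE)
    show "AE \<omega> in W. (\<omega> \<in> {\<omega>\<in>space W. (\<exists>t\<ge>1. walk G \<one> \<omega> t \<in> H) \<and> return_pos \<omega> = y})
      = (\<omega> \<in> return_pos -` {y} \<inter> space W)"
      using AE_returns by eventually_elim auto
    have "Measurable.pred W (\<lambda>\<omega>. return_pos \<omega> = y)"
      by (rule measurable_compose[OF return_pos_measurable_UNIV]) simp
    with m show "{\<omega>\<in>space W. (\<exists>t\<ge>1. walk G \<one> \<omega> t \<in> H) \<and> return_pos \<omega> = y} \<in> sets W"
      by measurable
    show "return_pos -` {y} \<inter> space W \<in> sets W"
      by (rule measurable_sets[OF return_pos_measurable_UNIV]) simp
  qed
  also have "\<dots> = measure (measure_pmf hit_pmf) {y}"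
    unfolding measure_hit_pmf by (subst measure_distr) auto
  finally show "hitting_law G H \<mu> y = pmf hit_pmf y" by (simp add: measure_pmf_single)
qed

text \<open>Split at the first position \<open>g\<close>: the change of \<open>F\<close> from
  \<open>g\<close> to the return point has mean at most \<open>C * L\<close>, uniformly in
  \<open>g\<close>, and the change from \<open>\<one>\<close> to \<open>g\<close> is controlled by
  the first moment. This gives integrability, after which the first-step formula for Bochner
  integrals yields the identity.\<close>

lemma hit_pmf_integral:
  assumes l: "lip L F"
  shows "integrable (measure_pmf hit_pmf) F"
    and "(LINT y|measure_pmf hit_pmf. F y) = (LINT g|measure_pmf \<mu>. hit_exp F g)"
proof -
  have mF: "(\<lambda>\<omega>. F (return_pos \<omega>)) \<in> borel_measurable W"
    by (rule measurable_compose[OF return_pos_measurable_UNIV]) simp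
  obtain C where C: "0 < C" "\<And>x. x \<in> carrier G \<Longrightarrow>
      (\<integral>\<^sup>+\<omega>. ennreal (cmod (stopped_value G H F x \<omega> - F x)) \<partial>W) \<le> ennreal (C * L)"
    using displacement_bound l by (elim exE conjE) simp
  have "(\<integral>\<^sup>+\<omega>. ennreal (cmod (F (return_pos \<omega>) - F \<one>)) \<partial>W)
      = (\<integral>\<^sup>+g. \<integral>\<^sup>+\<omega>. ennreal (cmod (F (return_pos (g ## \<omega>)) - F \<one>)) \<partial>W \<partial>measure_pmf \<mu>)"
    using mF by (intro nn_integral_W) auto
  also have "\<dots> \<le> (\<integral>\<^sup>+g. ennreal (C * L) + ennreal L * ennreal (real (word_length G S g)) \<partial>measure_pmf \<mu>)"
  proof (rule nn_integral_step_mono)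
    fix g assume g: "g \<in> carrier G"
    have "cmod (F g - F \<one>) \<le> L * real (word_length G S g)"
      using lip_bound[OF l one_closed g] g by simp
    then have d: "cmod ((a - F g) + (F g - F \<one>)) \<le> cmod (a - F g) + L * real (word_length G S g)" for a
      by (intro norm_triangle_mono order_refl)
    have "ennreal (cmod (a - F \<one>)) \<le> ennreal (cmod (a - F g)) + ennreal L * ennreal (real (word_length G S g))" for a
      using d[of a] l by (simp add: ennreal_mult[symmetric] ennreal_plus[symmetric] ennreal_leI del: ennreal_plus)
    then have "(\<integral>\<^sup>+\<omega>. ennreal (cmod (F (return_pos (g ## \<omega>)) - F \<one>)) \<partial>W)
      \<le> (\<integral>\<^sup>+\<omega>. ennreal (cmod (stopped_value G H F g \<omega> - F g)) + ennreal L * ennreal (real (word_length G S g)) \<partial>W)"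
      by (intro nn_integral_mono_AE, use AE_hits[OF g] in eventually_elim)
        (simp only: return_pos_Stream(1)[OF g])
    also have "\<dots> = (\<integral>\<^sup>+\<omega>. ennreal (cmod (stopped_value G H F g \<omega> - F g)) \<partial>W) + ennreal L * ennreal (real (word_length G S g))"
      using g by (subst nn_integral_add) (auto simp: W.emeasure_space_1)
    also have "\<dots> \<le> ennreal (C * L) + ennreal L * ennreal (real (word_length G S g))"
      by (intro add_right_mono C g)
    finally show "(\<integral>\<^sup>+\<omega>. ennreal (cmod (F (return_pos (g ## \<omega>)) - F \<one>)) \<partial>W)
      \<le> ennreal (C * L) + ennreal L * ennreal (real (word_length G S g))" .
  qed
  also have "\<dots> = ennreal (C * L) + ennreal L * (\<integral>\<^sup>+g. ennreal (real (word_length G S g)) \<partial>measure_pmf \<mu>)"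
    by (simp add: nn_integral_add nn_integral_cmult)
  also have "\<dots> < \<infinity>" using first_moment by (simp add: ennreal_mult_less_top)
  finally have "integrable W (\<lambda>\<omega>. F (return_pos \<omega>) - F \<one>)"
    using mF by (intro integrableI_bounded) auto
  then have "integrable W (\<lambda>\<omega>. (F (return_pos \<omega>) - F \<one>) + F \<one>)"
    by (rule Bochner_Integration.integrable_add) simp
  then have int: "integrable W (\<lambda>\<omega>. F (return_pos \<omega>))" by simp
  then show "integrable (measure_pmf hit_pmf) F"
    unfolding measure_hit_pmf by (subst integrable_distr_eq) auto
  have "(LINT y|measure_pmf hit_pmf. F y) = (LINT \<omega>|W. F (return_pos \<omega>))"
    unfolding measure_hit_pmf by (rule integral_distr) auto
  also have "\<dots> = (LINT g|M. LINT \<omega>|W. F (return_pos (g ## \<omega>)))"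
    using M.integral_stream_space(2)[of "\<lambda>\<omega>. F (return_pos \<omega>)"] int by (simp add: W_eq)
  also have "\<dots> = (LINT g|M. hit_exp F g)"
  proof (rule Bochner_Integration.integral_cong[OF refl])
    fix g assume "g \<in> space M"
    then have g: "g \<in> carrier G" by simp
    have "(\<lambda>\<omega>. F (return_pos (g ## \<omega>))) \<in> borel_measurable W"
      by (rule measurable_compose[OF _ mF]) (use g in \<open>simp add: W_eq\<close>)
    then show "(LINT \<omega>|W. F (return_pos (g ## \<omega>))) = hit_exp F g"
    proof (rule integral_cong_AE)
      show "AE \<omega> in W. F (return_pos (g ## \<omega>)) = stopped_value G H F g \<omega>"
        using AE_hits[OF g] by eventually_elim (rule return_pos_Stream(1)[OF g])
    qed (rule stopped_value_measurable[OF g])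
  qed
  also have "\<dots> = (LINT g|measure_pmf \<mu>. hit_exp F g)" by (rule integral_M)
  finally show "(LINT y|measure_pmf hit_pmf. F y) = (LINT g|measure_pmf \<mu>. hit_exp F g)" .
qed

text \<open>The bridge between the two notions of harmonicity: since
  \<open>hit_exp F k = f k\<close> on \<open>H\<close>, the right side says that the induced
  function has the \<open>\<mu>\<close>-mean value property at points of \<open>H\<close>. For each
  \<open>k\<close> the proof applies \<open>hit_pmf_integral\<close> to the left translate of
  \<open>F\<close> by \<open>k\<close>, which has the same Lipschitz constant, and moves
  \<open>k\<close> back by \<open>hit_exp_left_mult\<close>.\<close>

lemma harmonic_hitting_law_iff:
  assumes l: "lip L F" and f: "\<And>y. y \<in> H \<Longrightarrow> F y = f y"
  shows "harmonic (G\<lparr>carrier := H\<rparr>) (hitting_law G H \<mu>) f \<longleftrightarrow>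
    (\<forall>k\<in>H. f k = (LINT g|measure_pmf \<mu>. hit_exp F (k \<otimes> g)))"
proof -
  have AE_H: "AE y in measure_pmf hit_pmf. f (k \<otimes> y) = F (k \<otimes> y)" if "k \<in> H" for k
    using set_hit_pmf that f by (auto simp: AE_measure_pmf_iff subset_iff)
  have "harmonic (G\<lparr>carrier := H\<rparr>) (hitting_law G H \<mu>) f \<longleftrightarrow>
    (\<forall>k\<in>H. integrable (measure_pmf hit_pmf) (\<lambda>y. f (k \<otimes> y)) \<and>
       f k = (LINT y|measure_pmf hit_pmf. f (k \<otimes> y)))"
    unfolding hitting_law_eq using harmonic_pmf_iff[of hit_pmf "G\<lparr>carrier := H\<rparr>" f] set_hit_pmf by simp
  also have "\<dots> \<longleftrightarrow> (\<forall>k\<in>H. f k = (LINT g|measure_pmf \<mu>. hit_exp F (k \<otimes> g)))"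
  proof (rule ball_cong[OF refl])
    fix k assume k: "k \<in> H"
    have lk: "lip L (\<lambda>y. F (k \<otimes> y))"
      using l k gen H.mem_carrier by (auto simp: m_assoc[symmetric] fin_sym_gen_def subset_iff)
    have "integrable (measure_pmf hit_pmf) (\<lambda>y. f (k \<otimes> y))"
      using hit_pmf_integral(1)[OF lk] by (rule integrable_cong_AE_imp) (use AE_H[OF k] in auto)
    moreover have "(LINT y|measure_pmf hit_pmf. f (k \<otimes> y)) = (LINT y|measure_pmf hit_pmf. F (k \<otimes> y))"
      by (rule integral_cong_AE) (use AE_H[OF k] in auto)
    moreover have "\<dots> = (LINT g|measure_pmf \<mu>. hit_exp F (k \<otimes> g))"
      unfolding hit_pmf_integral(2)[OF lk]
      by (rule integral_cong_AE) (auto intro!: AE_step hit_exp_left_mult k)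
    ultimately show "(integrable (measure_pmf hit_pmf) (\<lambda>y. f (k \<otimes> y)) \<and>
       f k = (LINT y|measure_pmf hit_pmf. f (k \<otimes> y))) \<longleftrightarrow>
       f k = (LINT g|measure_pmf \<mu>. hit_exp F (k \<otimes> g))" by simp
  qed
  finally show ?thesis .
qed

section \<open>Restriction and harmonic induction\<close>

lemma Ind_eq: "x \<in> carrier G \<Longrightarrow> Ind G H \<mu> f x = hit_exp f x"
  by (simp add: Ind_def)

lemma hit_exp_cong: "(\<And>y. y \<in> H \<Longrightarrow> f y = f' y) \<Longrightarrow> hit_exp f x = hit_exp f' x"
  using stopped_value_cong[of H f f' G x] by simp

text \<open>Transfers bounds from an arbitrary generating set to the fixed \<open>S\<close>, in
  terms of which all walk estimates are stated.\<close>

lemma lip_of_generators: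
  assumes "fin_sym_gen G S\<^sub>G"
  shows "\<exists>c>0. \<forall>F L. 0 \<le> L \<longrightarrow>
    (\<forall>s\<in>S\<^sub>G. \<forall>x\<in>carrier G. cmod (F (x \<otimes> s) - F x) \<le> L) \<longrightarrow> lip (c * L) F"
proof -
  have "finite S" "S \<subseteq> carrier G" using gen by (auto simp: fin_sym_gen_def)
  from lipschitz_finite_set[OF assms this] obtain c where c: "0 < c"
    "\<And>f L z x. z \<in> S \<Longrightarrow> x \<in> carrier G \<Longrightarrow> 0 \<le> L \<Longrightarrow>
    (\<And>s x. s \<in> S\<^sub>G \<Longrightarrow> x \<in> carrier G \<Longrightarrow> cmod (f (x \<otimes> s) - f x) \<le> L) \<Longrightarrow>
    cmod (f (x \<otimes> z) - f x) \<le> c * L" by metis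
  show ?thesis by (intro exI[of _ c]) (use c in auto)
qed

text \<open>The three claims are proved together because they all rest on one choice of the
  extension \<open>F\<close>.\<close>

lemma Ind_lipschitz_const:
  assumes SG: "fin_sym_gen G S\<^sub>G" and SH: "fin_sym_gen (G\<lparr>carrier := H\<rparr>) S\<^sub>H"
  shows "\<exists>C>0. \<forall>f\<in>LHF (G\<lparr>carrier := H\<rparr>) S\<^sub>H (hitting_law G H \<mu>).
    grad_norm G S\<^sub>G (Ind G H \<mu> f) \<le> ennreal C * grad_norm (G\<lparr>carrier := H\<rparr>) S\<^sub>H f \<and>
    (\<forall>x\<in>carrier G. integrable W (stopped_value G H f x)) \<and>
    Ind G H \<mu> f \<in> LHF G S\<^sub>G (pmf \<mu>)"
proof -
  obtain c where c: "0 < c" "\<And>f L. 0 \<le> L \<Longrightarrow>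
    (\<And>s x. s \<in> S\<^sub>H \<Longrightarrow> x \<in> H \<Longrightarrow> cmod (f (x \<otimes> s) - f x) \<le> L) \<Longrightarrow>
    \<exists>F. (\<forall>x\<in>H. F x = f x) \<and> (\<forall>s\<in>S. \<forall>x\<in>carrier G. cmod (F (x \<otimes> s) - F x) \<le> c * L)"
    using lipschitz_extension[OF gen subH fin_index SH] by metis
  obtain C where C: "0 < C" "\<And>F L x. lip L F \<Longrightarrow> x \<in> carrier G \<Longrightarrow>
      integrable W (stopped_value G H F x) \<and> cmod (hit_exp F x - F x) \<le> C * L"
    using hit_exp_bound by (elim exE conjE) simp
  have SGc: "finite S\<^sub>G" "S\<^sub>G \<subseteq> carrier G" using SG by (auto simp: fin_sym_gen_def)
  obtain d where d: "0 < d" "\<And>f L z x. z \<in> S\<^sub>G \<Longrightarrow> x \<in> carrier G \<Longrightarrow> 0 \<le> L \<Longrightarrow>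
    (\<And>s x. s \<in> S \<Longrightarrow> x \<in> carrier G \<Longrightarrow> cmod (f (x \<otimes> s) - f x) \<le> L) \<Longrightarrow>
    cmod (f (x \<otimes> z) - f x) \<le> d * L"
    using lipschitz_finite_set[OF gen SGc] by metis
  obtain e where e: "0 < e" "\<And>F L. 0 \<le> L \<Longrightarrow>
    (\<forall>s\<in>S\<^sub>G. \<forall>x\<in>carrier G. cmod (F (x \<otimes> s) - F x) \<le> L) \<Longrightarrow> lip (e * L) F"
    using lip_of_generators[OF SG] by (elim exE conjE) simp
  \<comment> \<open>\<open>c\<close> is the cost of extending \<open>f\<close> to \<open>F\<close>;
    \<open>C\<close> occurs twice, for replacing the induced function by \<open>F\<close> at
    \<open>x \<otimes> s\<close> and at \<open>x\<close>; \<open>d\<close> bounds the change of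
    \<open>F\<close> along a generator in \<open>S\<^sub>G\<close>.\<close>
  define C1 where "C1 = (2 * C + d) * c"
  have C1: "0 < C1" using C(1) c(1) d(1) by (simp add: C1_def add_pos_pos)
  have main: "grad_norm G S\<^sub>G (Ind G H \<mu> f) \<le> ennreal C1 * grad_norm (G\<lparr>carrier := H\<rparr>) S\<^sub>H f \<and>
    (\<forall>x\<in>carrier G. integrable W (stopped_value G H f x)) \<and>
    Ind G H \<mu> f \<in> LHF G S\<^sub>G (pmf \<mu>)"
    if f: "f \<in> LHF (G\<lparr>carrier := H\<rparr>) S\<^sub>H (hitting_law G H \<mu>)" for f
  proof -
    obtain L where L: "0 \<le> L" "grad_norm (G\<lparr>carrier := H\<rparr>) S\<^sub>H f = ennreal L"
      "\<And>s x. s \<in> S\<^sub>H \<Longrightarrow> x \<in> H \<Longrightarrow> cmod (f (x \<otimes> s) - f x) \<le> L"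
      using f by (rule LHF_lipschitzE) simp
    have "\<exists>F. (\<forall>x\<in>H. F x = f x) \<and> (\<forall>s\<in>S. \<forall>x\<in>carrier G. cmod (F (x \<otimes> s) - F x) \<le> c * L)"
      by (rule c(2)[OF L(1)]) (rule L(3))
    then obtain F where F: "\<forall>x\<in>H. F x = f x" "\<forall>s\<in>S. \<forall>x\<in>carrier G. cmod (F (x \<otimes> s) - F x) \<le> c * L"
      by (elim exE conjE)
    have l: "lip (c * L) F" using F(2) c(1) L(1) by simp
    have Ff: "stopped_value G H F x = stopped_value G H f x" for x
      using stopped_value_cong[of H F f G x] F(1) by (intro ext) simp
    have I: "Ind G H \<mu> f x = hit_exp F x" if "x \<in> carrier G" for x
      using that by (simp add: Ind_eq Ff)
    have lipI: "cmod (Ind G H \<mu> f (x \<otimes> s) - Ind G H \<mu> f x) \<le> C1 * L"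
      if s: "s \<in> S\<^sub>G" and x: "x \<in> carrier G" for s x
    proof -
      have xs: "x \<otimes> s \<in> carrier G" using s x SGc by auto
      have "cmod (F (x \<otimes> s) - F x) \<le> d * (c * L)"
        using s x l by (intro d(2)) auto
      moreover have "cmod (hit_exp F (x \<otimes> s) - F (x \<otimes> s)) \<le> C * (c * L)"
        using C(2)[OF l xs] by simp
      moreover have "cmod (F x - hit_exp F x) \<le> C * (c * L)"
        using C(2)[OF l x] by (simp add: norm_minus_commute)
      ultimately have "cmod ((hit_exp F (x \<otimes> s) - F (x \<otimes> s)) + (F (x \<otimes> s) - F x) + (F x - hit_exp F x))
        \<le> C * (c * L) + d * (c * L) + C * (c * L)"
        by (intro norm_triangle_mono)
      then show ?thesis unfolding I[OF xs] I[OF x] by (simp add: C1_def algebra_simps)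
    qed
    have gr: "grad_norm G S\<^sub>G (Ind G H \<mu> f) \<le> ennreal (C1 * L)"
      using lipI C1 L(1) by (subst grad_norm_le_iff) auto
    \<comment> \<open>Integrability of the induced function against \<open>\<mu>\<close> is
      available for Lipschitz bounds along \<open>S\<close>, hence the conversion factor
      \<open>e\<close>.\<close>
    have lI: "lip (e * (C1 * L)) (Ind G H \<mu> f)"
      using lipI C1 L(1) by (intro e(2)) auto
    have "harmonic G (pmf \<mu>) (Ind G H \<mu> f)"
      unfolding harmonic_pmf_iff[OF supp]
    proof (intro ballI conjI)
      fix x assume x: "x \<in> carrier G"
      show "integrable (measure_pmf \<mu>) (\<lambda>g. Ind G H \<mu> f (x \<otimes> g))"
        by (rule lip_integrable_step[OF lI x])
      have "(LINT g|measure_pmf \<mu>. Ind G H \<mu> f (x \<otimes> g)) = (LINT g|measure_pmf \<mu>. hit_exp F (x \<otimes> g))"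
        by (rule integral_cong_AE) (auto intro!: AE_step I x)
      also have "\<dots> = hit_exp F x"
      proof (cases "x \<in> H")
        case True
        have "harmonic (G\<lparr>carrier := H\<rparr>) (hitting_law G H \<mu>) f" using f by (simp add: LHF_def)
        then have "\<forall>k\<in>H. f k = (LINT g|measure_pmf \<mu>. hit_exp F (k \<otimes> g))"
          using harmonic_hitting_law_iff[OF l, of f] F(1) by blast
        then show ?thesis using True F(1) hit_exp_in[OF True, of F] by simp
      next
        case False
        then show ?thesis
          using hit_exp_step(2)[OF integrable_stopped_value[OF l x]] by simp
      qed
      finally show "Ind G H \<mu> f x = (LINT g|measure_pmf \<mu>. Ind G H \<mu> f (x \<otimes> g))"
        using I[OF x] by simp
    qed
    moreover have "Ind G H \<mu> f \<in> extensional (carrier G)" by (simp add: Ind_def)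
    moreover have "grad_norm G S\<^sub>G (Ind G H \<mu> f) < \<infinity>" using gr by (auto intro: le_less_trans)
    ultimately have "Ind G H \<mu> f \<in> LHF G S\<^sub>G (pmf \<mu>)" by (simp add: LHF_def)
    moreover have "grad_norm G S\<^sub>G (Ind G H \<mu> f) \<le> ennreal C1 * grad_norm (G\<lparr>carrier := H\<rparr>) S\<^sub>H f"
      using gr C1 L(1) by (simp add: L(2) ennreal_mult)
    moreover have "\<forall>x\<in>carrier G. integrable W (stopped_value G H f x)"
      using integrable_stopped_value[OF l] by (simp add: Ff)
    ultimately show ?thesis by (intro conjI)
  qed
  show ?thesis by (intro exI[of _ C1] conjI ballI C1) (use main in auto)
qed

text \<open>The second claim is drawn from the first: no optional stopping theorem is applied to
  \<open>f\<close>; its conclusion, \<open>hit_exp f = f\<close>, comes from uniqueness.\<close>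

lemma Ind_Res:
  assumes SG: "fin_sym_gen G S\<^sub>G" and f: "f \<in> LHF G S\<^sub>G (pmf \<mu>)"
  shows "Ind G H \<mu> (Res H f) = f"
    and "harmonic (G\<lparr>carrier := H\<rparr>) (hitting_law G H \<mu>) (Res H f)"
proof -
  obtain e where e: "0 < e" "\<And>F L. 0 \<le> L \<Longrightarrow>
    (\<forall>s\<in>S\<^sub>G. \<forall>x\<in>carrier G. cmod (F (x \<otimes> s) - F x) \<le> L) \<Longrightarrow> lip (e * L) F"
    using lip_of_generators[OF SG] by (elim exE conjE) simp
  obtain L' where L': "0 \<le> L'" "grad_norm G S\<^sub>G f = ennreal L'"
    "\<And>s x. s \<in> S\<^sub>G \<Longrightarrow> x \<in> carrier G \<Longrightarrow> cmod (f (x \<otimes> s) - f x) \<le> L'"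
    using f by (rule LHF_lipschitzE) simp
  define L where "L = e * L'"
  have l: "lip L f" unfolding L_def using L' by (intro e(2)) auto
  obtain C where C: "0 < C" "\<And>F L x. lip L F \<Longrightarrow> x \<in> carrier G \<Longrightarrow>
      integrable W (stopped_value G H F x) \<and> cmod (hit_exp F x - F x) \<le> C * L"
    using hit_exp_bound by (elim exE conjE) simp
  have h: "integrable (measure_pmf \<mu>) (\<lambda>g. f (x \<otimes> g))" "f x = (LINT g|measure_pmf \<mu>. f (x \<otimes> g))"
    if "x \<in> carrier G" for x
    using f that by (auto simp: LHF_def harmonic_pmf_iff[OF supp])
  \<comment> \<open>Both functions may be unbounded, but their difference is bounded by
    \<open>C * L\<close> through \<open>hit_exp_bound\<close>.\<close>
  have zero: "hit_exp f x - f x = 0" if "x \<in> carrier G" for x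
  proof (rule bounded_harmonic_off_H_eq_0[where B="C * L" and D="\<lambda>x. hit_exp f x - f x"])
    fix x assume x: "x \<in> carrier G"
    show "cmod (hit_exp f x - f x) \<le> C * L" using C(2)[OF l x] by simp
    assume nx: "x \<notin> H"
    note s = hit_exp_step[OF integrable_stopped_value[OF l x] nx]
    show "integrable (measure_pmf \<mu>) (\<lambda>g. hit_exp f (x \<otimes> g) - f (x \<otimes> g))"
      by (rule Bochner_Integration.integrable_diff[OF s(1) h(1)[OF x]])
    show "hit_exp f x - f x = (LINT g|measure_pmf \<mu>. hit_exp f (x \<otimes> g) - f (x \<otimes> g))"
      unfolding Bochner_Integration.integral_diff[OF s(1) h(1)[OF x]]
      using s(2) h(2)[OF x] by simp
  qed (use that hit_exp_in in auto)
  show "Ind G H \<mu> (Res H f) = f"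
  proof (rule extensionalityI[where A="carrier G"])
    show "Ind G H \<mu> (Res H f) \<in> extensional (carrier G)" by (simp add: Ind_def)
    show "f \<in> extensional (carrier G)" using f by (simp add: LHF_def)
    fix x assume x: "x \<in> carrier G"
    have "hit_exp (Res H f) x = hit_exp f x" by (rule hit_exp_cong) (simp add: Res_def)
    then show "Ind G H \<mu> (Res H f) x = f x" using x zero[OF x] by (simp add: Ind_eq)
  qed
  \<comment> \<open>With \<open>hit_exp f\<close> equal to \<open>f\<close>, the criterion for the
    hitting law, taken with \<open>F = f\<close>, becomes harmonicity of \<open>f\<close> at
    \<open>k\<close>.\<close>
  have "f k = (LINT g|measure_pmf \<mu>. hit_exp f (k \<otimes> g))" if k: "k \<in> H" for k
  proof -
    have kG: "k \<in> carrier G" using k by (rule H.mem_carrier)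
    have "(LINT g|measure_pmf \<mu>. hit_exp f (k \<otimes> g)) = (LINT g|measure_pmf \<mu>. f (k \<otimes> g))"
      using zero kG by (intro integral_cong_AE) (auto intro!: AE_step)
    then show ?thesis using h(2)[OF kG] by simp
  qed
  then show "harmonic (G\<lparr>carrier := H\<rparr>) (hitting_law G H \<mu>) (Res H f)"
    by (subst harmonic_hitting_law_iff[OF l]) (auto simp: Res_def)
qed

text \<open>Each of the finitely many generators of \<open>H\<close> is a word over
  \<open>S\<^sub>G\<close>, and \<open>d\<close> is built from the lengths of these words.
  Harmonicity of the restriction is supplied by \<open>Ind_Res\<close>.\<close>

lemma Res_lipschitz_const:
  assumes SG: "fin_sym_gen G S\<^sub>G" and SH: "fin_sym_gen (G\<lparr>carrier := H\<rparr>) S\<^sub>H"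
  shows "\<exists>C>0. \<forall>f\<in>LHF G S\<^sub>G (pmf \<mu>).
    grad_norm (G\<lparr>carrier := H\<rparr>) S\<^sub>H (Res H f) \<le> ennreal C * grad_norm G S\<^sub>G f \<and>
    Res H f \<in> LHF (G\<lparr>carrier := H\<rparr>) S\<^sub>H (hitting_law G H \<mu>)"
proof -
  have SHc: "finite S\<^sub>H" "S\<^sub>H \<subseteq> H" using SH by (auto simp: fin_sym_gen_def)
  then have "S\<^sub>H \<subseteq> carrier G" using H.subset by blast
  obtain d where d: "0 < d" "\<And>f L z x. z \<in> S\<^sub>H \<Longrightarrow> x \<in> carrier G \<Longrightarrow> 0 \<le> L \<Longrightarrow>
    (\<And>s x. s \<in> S\<^sub>G \<Longrightarrow> x \<in> carrier G \<Longrightarrow> cmod (f (x \<otimes> s) - f x) \<le> L) \<Longrightarrow>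
    cmod (f (x \<otimes> z) - f x) \<le> d * L"
    using lipschitz_finite_set[OF SG SHc(1) \<open>S\<^sub>H \<subseteq> carrier G\<close>] by metis
  have main: "grad_norm (G\<lparr>carrier := H\<rparr>) S\<^sub>H (Res H f) \<le> ennreal d * grad_norm G S\<^sub>G f \<and>
    Res H f \<in> LHF (G\<lparr>carrier := H\<rparr>) S\<^sub>H (hitting_law G H \<mu>)"
    if f: "f \<in> LHF G S\<^sub>G (pmf \<mu>)" for f
  proof -
    obtain L where L: "0 \<le> L" "grad_norm G S\<^sub>G f = ennreal L"
      "\<And>s x. s \<in> S\<^sub>G \<Longrightarrow> x \<in> carrier G \<Longrightarrow> cmod (f (x \<otimes> s) - f x) \<le> L"
      using f by (rule LHF_lipschitzE) simp
    have "cmod (f (x \<otimes> s) - f x) \<le> d * L" if "s \<in> S\<^sub>H" "x \<in> H" for s x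
      using that L by (intro d(2)) auto
    then have gr: "grad_norm (G\<lparr>carrier := H\<rparr>) S\<^sub>H (Res H f) \<le> ennreal (d * L)"
      using SHc d(1) L(1) by (subst grad_norm_le_iff) (auto simp: Res_def subset_iff)
    then have "grad_norm (G\<lparr>carrier := H\<rparr>) S\<^sub>H (Res H f) < \<infinity>" by (auto intro: le_less_trans)
    then have "Res H f \<in> LHF (G\<lparr>carrier := H\<rparr>) S\<^sub>H (hitting_law G H \<mu>)"
      using Ind_Res(2)[OF SG f] by (simp add: LHF_def Res_def)
    then show ?thesis using gr d(1) L(1) by (simp add: L(2) ennreal_mult)
  qed
  show ?thesis by (intro exI[of _ d] conjI ballI d(1)) (use main in auto)
qed

lemma Res_Ind:
  assumes "f \<in> extensional H"
  shows "Res H (Ind G H \<mu> f) = f"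
proof (rule extensionalityI[where A=H])
  show "Res H (Ind G H \<mu> f) x = f x" if "x \<in> H" for x
    using that by (simp add: Res_def Ind_eq hit_exp_in H.mem_carrier)
qed (use assms in \<open>simp_all add: Res_def\<close>)

lemma linear_iso_Res:
  assumes SG: "fin_sym_gen G S\<^sub>G" and SH: "fin_sym_gen (G\<lparr>carrier := H\<rparr>) S\<^sub>H"
  shows "linear_iso (carrier G) (LHF G S\<^sub>G (pmf \<mu>)) H
    (LHF (G\<lparr>carrier := H\<rparr>) S\<^sub>H (hitting_law G H \<mu>)) (Res H)"
  unfolding linear_iso_def
proof (intro conjI ballI allI)
  let ?V = "LHF G S\<^sub>G (pmf \<mu>)" and ?U = "LHF (G\<lparr>carrier := H\<rparr>) S\<^sub>H (hitting_law G H \<mu>)"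
  show "function_subspace (carrier G) ?V"
    using SG by (intro LHF_function_subspace is_group) (simp add: fin_sym_gen_def)
  show "function_subspace H ?U"
    using LHF_function_subspace[OF subgroup_imp_group[OF subH]] SH by (simp add: fin_sym_gen_def)
  show "bij_betw (Res H) ?V ?U"
  proof (rule bij_betw_byWitness[where f'="Ind G H \<mu>"])
    show "\<forall>f\<in>?V. Ind G H \<mu> (Res H f) = f" using Ind_Res(1)[OF SG] by blast
    show "\<forall>f\<in>?U. Res H (Ind G H \<mu> f) = f" by (simp add: Res_Ind LHF_def)
    show "Res H ` ?V \<subseteq> ?U" using Res_lipschitz_const[OF SG SH] by auto
    show "Ind G H \<mu> ` ?U \<subseteq> ?V" using Ind_lipschitz_const[OF SG SH] by auto
  qed
qed (auto simp: Res_def fun_eq_iff H.mem_carrier)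

end

text \<open>The first three conjuncts give the rest its intended meaning: the quantification over
  \<open>S\<^sub>H\<close> is not vacuous, the hitting law is a probability on \<open>H\<close>, and
  the default value of \<open>stopped_value\<close> matters only on a null set. The integrability
  clause likewise ensures that \<open>Ind\<close> is a true expectation. Both constants are chosen
  after the generating sets and before the functions.\<close>

theorem theorem3:
  fixes G :: "('a, 'b) monoid_scheme" and H S :: "'a set" and \<mu> :: "'a pmf"
  assumes "group G"
    and "fin_sym_gen G S"
    and "subgroup H G"
    and "finite (rcosets\<^bsub>G\<^esub> H)"
    and "set_pmf \<mu> \<subseteq> carrier G"
    and "adapted G \<mu>"
    and "smooth G S \<mu>"
  shows "(\<exists>S\<^sub>H. fin_sym_gen (G\<lparr>carrier := H\<rparr>) S\<^sub>H) \<and>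
    (hitting_law G H \<mu> has_sum 1) H \<and>
    (\<forall>x\<in>carrier G. AE \<omega> in walk_space G \<mu>. hitting_time 0 H (walk G x \<omega>) < \<infinity>) \<and>
    (\<forall>S\<^sub>G S\<^sub>H. fin_sym_gen G S\<^sub>G \<longrightarrow> fin_sym_gen (G\<lparr>carrier := H\<rparr>) S\<^sub>H \<longrightarrow>
      (let LHF_G = LHF G S\<^sub>G (pmf \<mu>);
           LHF_H = LHF (G\<lparr>carrier := H\<rparr>) S\<^sub>H (hitting_law G H \<mu>)
       in linear_iso (carrier G) LHF_G H LHF_H (Res H) \<and>
          (\<forall>f'\<in>LHF_H. \<forall>x\<in>carrier G. integrable (walk_space G \<mu>) (stopped_value G H f' x)) \<and>
          (\<forall>f'\<in>LHF_H. Ind G H \<mu> f' \<in> LHF_G \<and> Res H (Ind G H \<mu> f') = f') \<and>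
          (\<forall>f\<in>LHF_G. Ind G H \<mu> (Res H f) = f) \<and>
          (\<exists>C\<^sub>1>0. \<exists>C\<^sub>2>0.
             (\<forall>f'\<in>LHF_H. grad_norm G S\<^sub>G (Ind G H \<mu> f')
                \<le> ennreal C\<^sub>1 * grad_norm (G\<lparr>carrier := H\<rparr>) S\<^sub>H f') \<and>
             (\<forall>f\<in>LHF_G. grad_norm (G\<lparr>carrier := H\<rparr>) S\<^sub>H (Res H f)
                \<le> ennreal C\<^sub>2 * grad_norm G S\<^sub>G f))))"
proof -
  interpret group G by fact
  interpret finite_index_walk G H S \<mu> using assms by (intro finite_index_walk.intro finite_index_walk_axioms.intro)
  show ?thesis
  proof (intro conjI allI impI ballI)
    show "\<exists>S\<^sub>H. fin_sym_gen (G\<lparr>carrier := H\<rparr>) S\<^sub>H"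
      by (rule schreier_generators[OF gen subH fin_index])
    show "(hitting_law G H \<mu> has_sum 1) H"
      unfolding hitting_law_eq by (rule pmf_has_sum_one[OF set_hit_pmf])
    show "AE \<omega> in walk_space G \<mu>. hitting_time 0 H (walk G x \<omega>) < \<infinity>" if "x \<in> carrier G" for x
      unfolding hitting_time_finite_iff using AE_hits[OF that] by simp
  next
    fix S\<^sub>G S\<^sub>H assume SG: "fin_sym_gen G S\<^sub>G" and SH: "fin_sym_gen (G\<lparr>carrier := H\<rparr>) S\<^sub>H"
    let ?V = "LHF G S\<^sub>G (pmf \<mu>)" and ?U = "LHF (G\<lparr>carrier := H\<rparr>) S\<^sub>H (hitting_law G H \<mu>)"
    obtain C\<^sub>1 where C1: "C\<^sub>1 > 0" "\<forall>f\<in>?U.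
      grad_norm G S\<^sub>G (Ind G H \<mu> f) \<le> ennreal C\<^sub>1 * grad_norm (G\<lparr>carrier := H\<rparr>) S\<^sub>H f \<and>
      (\<forall>x\<in>carrier G. integrable W (stopped_value G H f x)) \<and> Ind G H \<mu> f \<in> ?V"
      using Ind_lipschitz_const[OF SG SH] by (elim exE conjE)
    obtain C\<^sub>2 where C2: "C\<^sub>2 > 0" "\<forall>f\<in>?V.
      grad_norm (G\<lparr>carrier := H\<rparr>) S\<^sub>H (Res H f) \<le> ennreal C\<^sub>2 * grad_norm G S\<^sub>G f \<and> Res H f \<in> ?U"
      using Res_lipschitz_const[OF SG SH] by (elim exE conjE)
    have RI: "\<forall>f\<in>?U. Res H (Ind G H \<mu> f) = f" by (simp add: Res_Ind LHF_def)
    have IR: "\<forall>f\<in>?V. Ind G H \<mu> (Res H f) = f" using Ind_Res(1)[OF SG] by blast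
    show "let LHF_G = ?V; LHF_H = ?U
       in linear_iso (carrier G) LHF_G H LHF_H (Res H) \<and>
          (\<forall>f'\<in>LHF_H. \<forall>x\<in>carrier G. integrable (walk_space G \<mu>) (stopped_value G H f' x)) \<and>
          (\<forall>f'\<in>LHF_H. Ind G H \<mu> f' \<in> LHF_G \<and> Res H (Ind G H \<mu> f') = f') \<and>
          (\<forall>f\<in>LHF_G. Ind G H \<mu> (Res H f) = f) \<and>
          (\<exists>C\<^sub>1>0. \<exists>C\<^sub>2>0.
             (\<forall>f'\<in>LHF_H. grad_norm G S\<^sub>G (Ind G H \<mu> f')
                \<le> ennreal C\<^sub>1 * grad_norm (G\<lparr>carrier := H\<rparr>) S\<^sub>H f') \<and>
             (\<forall>f\<in>LHF_G. grad_norm (G\<lparr>carrier := H\<rparr>) S\<^sub>H (Res H f)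
                \<le> ennreal C\<^sub>2 * grad_norm G S\<^sub>G f))"
      unfolding Let_def
      using linear_iso_Res[OF SG SH] C1 C2 RI IR
      by (intro conjI exI[of _ C\<^sub>1] exI[of _ C\<^sub>2]) simp_all
  qed
qed

end
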